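(* Let $k\ge 0$ and $m_1,\dots,m_k\ge 0$ be integers such that $l=\left(\sum_{i=1}^k m_i\right)-k+1\ge 0$, and let $\xi:X_{m_1}\otimes\cdots\otimes X_{m_k}\to X_l$ be a morphism of $K\mathbf{1}$. Then $\xi$ is a tree (that is, $\xi=\xi_T$ for some combed tree $T$ with nodes $N_1,\dots,N_k$, where $N_i$ has $m_i$ inputs) if and only if $\xi$ is allowable.
   Context: **Shapes.** Shapes are formal objects generated by: $I$ and $1$ are shapes; if $S,T$ are shapes so are $S\otimes T$ and $[S,T]$. We work strictly: $(T\otimes S)\otimes R=T\otimes(S\otimes R)$, $T\otimes I=T=I\otimes T$. Each shape $T$ has a list $v(T)$ of signs (its variables with their variances): $v(I)=\emptyset$, $v(1)=\{+\}$, $v(T\otimes S)=v(T)\sqcup v(S)$, $v([T,S])=v(T)^{\mathrm{op}}\sqcup v(S)$, where $\sqcup$ is concatenation and $(-)^{\mathrm{op}}$ reverses all signs. **Graphs.** A (Kelly–Mac Lane) graph $T\to S$ is a fixed-point-free pairing of the variables of $T$ and $S$ such that paired elements ("mates") have opposite variances in $v(T)^{\mathrm{op}}\sqcup v(S)$. Graphs $f:T\to S$, $g:S\to R$ compose to $gf:T\to R$ by gluing along the variables of $S$ and following paths (closed loops arising among the variables of $S$ are discarded). $K\mathbf{1}$ is the category of shapes and graphs. For $f:T\to T'$, $g:S\to S'$, both $f\otimes g:T\otimes S\to T'\otimes S'$ and $[f,g]:[T',S]\to[T,S']$ are given by the disjoint union of the pairings of $f$ and $g$. **Allowable morphisms.**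 The smallest class of morphisms of $K\mathbf{1}$ that contains, for all shapes $T,S$: the identities; $c:T\otimes S\to S\otimes T$ (pairing the two copies of $T$ variable by variable, and likewise the two copies of $S$); $d:T\to[S,T\otimes S]$ (pairing the two copies of $T$, and the two copies of $S$ in the codomain); $e:[T,S]\otimes T\to S$ (pairing the two copies of $T$ in the domain, and the two copies of $S$); and that is closed under $f\otimes g$, $[f,g]$ and composition. (The associativity and unit constraints are identities in the strict setting.) **Notation.** $X_m=[1^{\otimes m},1]$ for $m\ge 0$, with $1^{\otimes 0}=I$; an empty tensor product of $X$'s is $I$. **Trees.** A planar tree is (inductively) either the null tree (a single edge with no nodes, which is both its only leaf and its root), or a root node having $n\ge 0$ ordered inputs and one output (the root of the tree), with a planar tree attached by its root to each input. Its leaves are the edges not attached to the output of any node (a node may have $0$ inputs), ordered left to right. A tree (combed tree with ordered nodes) is a triple $(T,\rho,\tau)$ with $T$ a planar tree with $k$ nodes and $l$ leaves, $\rho\in S_l$ a permutation, and $\tau$ a bijection from the nodes to $\{1,\dots,k\}$. Write $N_i=\tau^{-1}(i)$, and call the leaf in planar position $i$ the $\rho(i)$-th leaf of the tree. **The morphism $\xi_T$.** Let $N_i$ have $m_i$ inputs. Write $X_{m_i}=[A_{i1}\otimes\cdots\otimes A_{im_i},A_i]$ and $X_l=[B_1\otimes\cdots\otimes B_l,B]$, with all $A_{ij},A_i,B_p,B$ equal to $1$. In $\xi_T$: $A_{ij}$ is the mate of $A_r$ if the $j$th input of $N_i$ is joined to the output of $N_r$; $A_{ij}$ is the mate of $B_p$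 if the $j$th input of $N_i$ is the $p$th leaf of $T$; $A_r$ is the mate of $B$ if the output of $N_r$ is the root of $T$. For the null tree ($k=0$, $l=1$), $B_1$ is the mate of $B$. *)

theory Defs
  imports Main "HOL-Library.Disjoint_Sets" "HOL-Combinatorics.Permutations"
begin

text \<open>
  All positions (variables of a shape, inputs of a node, leaves, labels of nodes) are numbered
  from 0.
\<close>

section \<open>Shapes\<close>

text \<open>
  Shapes are taken modulo strict associativity and units of the tensor product, so they form
  the free monoid (under tensor, with unit \<open>I\<close>) on the shapes that are not proper tensor products,
  namely \<open>1\<close> and the \<open>[T, S]\<close>. A shape is the list of its tensor factors of these two kinds.
\<close>

datatype factor = One | Hom "factor list" "factor list"

type_synonym shape = "factor list"

abbreviation unit_shape :: shape where "unit_shape \<equiv> []"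

abbreviation one_shape :: shape where "one_shape \<equiv> [One]"

abbreviation tensor :: "shape \<Rightarrow> shape \<Rightarrow> shape" where "tensor T S \<equiv> T @ S"

abbreviation hom_shape :: "shape \<Rightarrow> shape \<Rightarrow> shape" where "hom_shape T S \<equiv> [Hom T S]"

definition tensor_list :: "shape list \<Rightarrow> shape" where
  "tensor_list Ts = foldr tensor Ts unit_shape"

definition X :: "nat \<Rightarrow> shape" where
  "X m = hom_shape (tensor_list (replicate m one_shape)) one_shape"

datatype sign = Plus | Minus

fun opp :: "sign \<Rightarrow> sign" where
  "opp Plus = Minus"
| "opp Minus = Plus"

primrec factor_vars :: "factor \<Rightarrow> sign list" where
  "factor_vars One = [Plus]"
| "factor_vars (Hom T S) =
     map opp (concat (map factor_vars T)) @ concat (map factor_vars S)"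

definition vars :: "shape \<Rightarrow> sign list" where
  "vars T = concat (map factor_vars T)"

lemma vars_simps:
  "vars unit_shape = []"
  "vars one_shape = [Plus]"
  "vars (tensor T S) = vars T @ vars S"
  "vars (hom_shape T S) = map opp (vars T) @ vars S"
  by (simp_all add: vars_def)

abbreviation nv :: "shape \<Rightarrow> nat" where "nv T \<equiv> length (vars T)"

section \<open>Graphs\<close>

datatype var = Dom nat | Cod nat

type_synonym graph = "var set set"

definition variables :: "shape \<Rightarrow> shape \<Rightarrow> var set" where
  "variables T S = Dom ` {..<nv T} \<union> Cod ` {..<nv S}"

text \<open>The variance of a variable of \<open>T\<close> or \<open>S\<close> in \<open>v(T)\<^sup>o\<^sup>p \<squnion> v(S)\<close>.\<close>

fun variance :: "shape \<Rightarrow> shape \<Rightarrow> var \<Rightarrow> sign" where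
  "variance T S (Dom i) = opp (vars T ! i)"
| "variance T S (Cod j) = vars S ! j"

text \<open>A pairing is the set of its pairs of mates \<open>{x, y}\<close>.\<close>

definition is_graph :: "shape \<Rightarrow> shape \<Rightarrow> graph \<Rightarrow> bool" where
  "is_graph T S f \<longleftrightarrow>
     partition_on (variables T S) f \<and>
     (\<forall>e\<in>f. card e = 2) \<and>
     (\<forall>x y. {x, y} \<in> f \<longrightarrow> variance T S x \<noteq> variance T S y)"

definition id_graph :: "shape \<Rightarrow> graph" where
  "id_graph T = {{Dom i, Cod i} | i. i < nv T}"

text \<open>The symmetry \<open>T \<otimes> S \<rightarrow> S \<otimes> T\<close>.\<close>

definition c_graph :: "shape \<Rightarrow> shape \<Rightarrow> graph" where
  "c_graph T S =
     {{Dom i, Cod (nv S + i)} | i. i < nv T} \<union>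
     {{Dom (nv T + j), Cod j} | j. j < nv S}"

text \<open>The coevaluation \<open>T \<rightarrow> [S, T \<otimes> S]\<close>.\<close>

definition d_graph :: "shape \<Rightarrow> shape \<Rightarrow> graph" where
  "d_graph T S =
     {{Dom i, Cod (nv S + i)} | i. i < nv T} \<union>
     {{Cod j, Cod (nv S + nv T + j)} | j. j < nv S}"

text \<open>The evaluation \<open>[T, S] \<otimes> T \<rightarrow> S\<close>.\<close>

definition e_graph :: "shape \<Rightarrow> shape \<Rightarrow> graph" where
  "e_graph T S =
     {{Dom i, Dom (nv T + nv S + i)} | i. i < nv T} \<union>
     {{Dom (nv T + j), Cod j} | j. j < nv S}"

fun shift :: "nat \<Rightarrow> nat \<Rightarrow> var \<Rightarrow> var" where
  "shift a b (Dom i) = Dom (a + i)"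
| "shift a b (Cod j) = Cod (b + j)"

fun swap_side :: "var \<Rightarrow> var" where
  "swap_side (Dom i) = Cod i"
| "swap_side (Cod j) = Dom j"

text \<open>\<open>f \<otimes> g\<close> for \<open>f : T \<rightarrow> T'\<close> and any \<open>g\<close>.\<close>

definition tensor_graph :: "shape \<Rightarrow> shape \<Rightarrow> graph \<Rightarrow> graph \<Rightarrow> graph" where
  "tensor_graph T T' f g = f \<union> (image (shift (nv T) (nv T'))) ` g"

text \<open>
  \<open>[f, g] : [T', S] \<rightarrow> [T, S']\<close> for \<open>f : T \<rightarrow> T'\<close> and \<open>g : S \<rightarrow> S'\<close>; it is contravariant in \<open>f\<close>,
  so the two sides of \<open>f\<close> are exchanged.
\<close>

definition hom_graph :: "shape \<Rightarrow> shape \<Rightarrow> graph \<Rightarrow> graph \<Rightarrow> graph" where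
  "hom_graph T T' f g = (image swap_side) ` f \<union> (image (shift (nv T') (nv T))) ` g"

text \<open>
  Gluing \<open>f : T \<rightarrow> S\<close> and \<open>g : S \<rightarrow> R\<close> along \<open>S\<close> gives a graph on the variables of \<open>T\<close> (\<open>Src\<close>),
  \<open>S\<close> (\<open>Mid\<close>) and \<open>R\<close> (\<open>Tgt\<close>). Its components are closed loops among the variables of \<open>S\<close> and
  paths whose two ends are variables of \<open>T\<close> and \<open>R\<close>. So the mate in the composite of such a
  variable is the other variable of \<open>T\<close> or \<open>R\<close> that is connected to it.
\<close>

datatype glued_var = Src nat | Mid nat | Tgt nat

fun glue_first :: "var \<Rightarrow> glued_var" where
  "glue_first (Dom i) = Src i"
| "glue_first (Cod j) = Mid j"

fun glue_second :: "var \<Rightarrow> glued_var" where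
  "glue_second (Dom i) = Mid i"
| "glue_second (Cod j) = Tgt j"

fun glue_outer :: "var \<Rightarrow> glued_var" where
  "glue_outer (Dom i) = Src i"
| "glue_outer (Cod j) = Tgt j"

definition glued_edges :: "graph \<Rightarrow> graph \<Rightarrow> glued_var set set" where
  "glued_edges g f = (image glue_first) ` f \<union> (image glue_second) ` g"

definition comp_graph :: "graph \<Rightarrow> graph \<Rightarrow> graph" where
  "comp_graph g f =
     {{x, y} | x y. x \<noteq> y \<and>
        (glue_outer x, glue_outer y) \<in> {(a, b). {a, b} \<in> glued_edges g f}\<^sup>*}"

section \<open>Allowable morphisms\<close>

inductive allowable :: "shape \<Rightarrow> shape \<Rightarrow> graph \<Rightarrow> bool" where
  allowable_id: "allowable T T (id_graph T)"
| allowable_c: "allowable (tensor T S) (tensor S T) (c_graph T S)"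
| allowable_d: "allowable T (hom_shape S (tensor T S)) (d_graph T S)"
| allowable_e: "allowable (tensor (hom_shape T S) T) S (e_graph T S)"
| allowable_tensor: "allowable T T' f \<Longrightarrow> allowable S S' g \<Longrightarrow>
    allowable (tensor T S) (tensor T' S') (tensor_graph T T' f g)"
| allowable_hom: "allowable T T' f \<Longrightarrow> allowable S S' g \<Longrightarrow>
    allowable (hom_shape T' S) (hom_shape T S') (hom_graph T T' f g)"
| allowable_comp: "allowable T S f \<Longrightarrow> allowable S R g \<Longrightarrow>
    allowable T R (comp_graph g f)"

section \<open>Trees\<close>

datatype planar_tree = Null_Tree | Node "planar_tree list"

text \<open>
  An edge of a planar tree is given by its address: \<open>[]\<close> is the root, and if the edge \<open>p\<close> is the
  output of a node, then \<open>p @ [j]\<close> is the \<open>j\<close>-th input of this node. A node is given by the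
  address of its output.
\<close>

primrec nodes :: "planar_tree \<Rightarrow> nat list set" where
  "nodes Null_Tree = {}"
| "nodes (Node ts) = insert [] (\<Union>i<length ts. (#) i ` (map nodes ts ! i))"

text \<open>The leaves, from left to right.\<close>

primrec leaves :: "planar_tree \<Rightarrow> nat list list" where
  "leaves Null_Tree = [[]]"
| "leaves (Node ts) = concat (map2 (\<lambda>i. map ((#) i)) [0..<length ts] (map leaves ts))"

text \<open>The number of inputs of the node \<open>p\<close> (the value is meaningless if \<open>p\<close> is not a node).\<close>

fun arity :: "planar_tree \<Rightarrow> nat list \<Rightarrow> nat" where
  "arity Null_Tree p = 0"
| "arity (Node ts) [] = length ts"
| "arity (Node ts) (i # p) = arity (ts ! i) p"

definition combed_tree :: "planar_tree \<Rightarrow> (nat \<Rightarrow> nat) \<Rightarrow> (nat list \<Rightarrow> nat) \<Rightarrow> bool" where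
  "combed_tree T \<rho> \<tau> \<longleftrightarrow>
     \<rho> permutes {..<length (leaves T)} \<and> bij_betw \<tau> (nodes T) {..<card (nodes T)}"

definition node_at :: "planar_tree \<Rightarrow> (nat list \<Rightarrow> nat) \<Rightarrow> nat \<Rightarrow> nat list" where
  "node_at T \<tau> i = inv_into (nodes T) \<tau> i"

definition node_arities :: "planar_tree \<Rightarrow> (nat list \<Rightarrow> nat) \<Rightarrow> nat list" where
  "node_arities T \<tau> = map (\<lambda>i. arity T (node_at T \<tau> i)) [0..<card (nodes T)]"

section \<open>The morphism of a tree\<close>

text \<open>
  The variables of \<open>X\<^bsub>m\<^esub>\<close> are its \<open>m\<close> arguments followed by its result, so in
  \<open>X\<^bsub>m\<^sub>0\<^esub> \<otimes> X\<^bsub>m\<^sub>1\<^esub> \<otimes> \<dots>\<close> the \<open>i\<close>-th factor is preceded by \<open>\<Sum>r<i. (m\<^sub>r + 1)\<close> variables.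
  The variables \<open>A\<^sub>i\<^sub>j\<close> and \<open>A\<^sub>i\<close> are \<open>var_in ms i j\<close> and \<open>var_out ms i\<close>.
\<close>

definition var_in :: "nat list \<Rightarrow> nat \<Rightarrow> nat \<Rightarrow> var" where
  "var_in ms i j = Dom ((\<Sum>r<i. (ms ! r + 1)) + j)"

definition var_out :: "nat list \<Rightarrow> nat \<Rightarrow> var" where
  "var_out ms i = Dom ((\<Sum>r<i. (ms ! r + 1)) + ms ! i)"

text \<open>
  \<open>B\<^sub>p\<close> is \<open>Cod p\<close> and \<open>B\<close> is \<open>Cod l\<close>. The leaf in planar position \<open>q\<close> is the \<open>\<rho> q\<close>-th leaf.
\<close>

definition tree_graph :: "planar_tree \<Rightarrow> (nat \<Rightarrow> nat) \<Rightarrow> (nat list \<Rightarrow> nat) \<Rightarrow> graph" where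
  "tree_graph T \<rho> \<tau> =
     (let k = card (nodes T); l = length (leaves T); ms = node_arities T \<tau>; N = node_at T \<tau> in
      {{var_in ms i j, var_out ms r} | i j r.
         i < k \<and> j < ms ! i \<and> r < k \<and> N i @ [j] = N r} \<union>
      {{var_in ms i j, Cod (\<rho> q)} | i j q.
         i < k \<and> j < ms ! i \<and> q < l \<and> N i @ [j] = leaves T ! q} \<union>
      {{var_out ms r, Cod l} | r. r < k \<and> N r = []} \<union>
      (if T = Null_Tree then {{Cod 0, Cod l}} else {}))"

end

theory Submission
  imports Defs
begin

text \<open>
  In a graph \<open>X\<^bsub>m\<^sub>1\<^esub> \<otimes> \<dots> \<otimes> X\<^bsub>m\<^sub>k\<^esub> \<rightarrow> X\<^sub>l\<close> the variances force every input \<open>A\<^sub>i\<^sub>j\<close>, and the result \<open>B\<close>, to be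
  the mate of an output \<open>A\<^sub>r\<close> or of an argument \<open>B\<^sub>p\<close>. Such a graph is thus a drawing of nodes in
  which each output runs to an input or to the root; it is a tree precisely when no output leads
  back to its own node, that is, when the relation of a node to its children is acyclic.

  Allowable graphs are acyclic in this sense because of a model with three values, which record how
  two points of a coherence space are related: incoherent, equal or coherent. Give a value to
  every variable, the same to mates; tensor and internal hom act on values as they do on the
  relation of points in coherence spaces. For the order incoherent \<open><\<close> equal \<open><\<close> coherent the values
  form a symmetric monoidal closed poset, so for an allowable \<open>T \<rightarrow> S\<close> the value of \<open>T\<close> is at most
  that of \<open>S\<close> (\<open>allowable_sound\<close>). This survives composition simply because a valuation of the
  composite extends along the paths through the middle shape. If the nodes of a nonempty set \<open>Q\<close> all
  had a child in \<open>Q\<close>, make the outputs of \<open>Q\<close> and their mates incoherent and all other variables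
  equal: the nodes of \<open>Q\<close> become coherent and no other node becomes incoherent, so the domain is coherent,
  whereas the codomain is not (\<open>sound_no_infinite_descent\<close>). Hence the child relation is
  well-founded, the tree grows downwards from \<open>B\<close> (\<open>labels_exist\<close>), and since its converse is
  well-founded too every node is reached (\<open>labelled_tree\<close>).

  Conversely, the morphism of a tree is built by induction on the tree from evaluations
  (\<open>tree_derivable\<close>): a node with inputs \<open>A\<^sub>1, \<dots>, A\<^sub>m\<close> evaluates \<open>[1 \<otimes> \<dots> \<otimes> 1, 1]\<close> at the tensor
  product of the morphisms of its subtrees. This gives a morphism from the tensor product of all
  nodes and all leaves, in the planar order, to \<open>1\<close>; permuting the factors and currying the leaves
  gives \<open>\<xi>\<^sub>T\<close> (\<open>tree_allowable\<close>). All composites in this construction only rename variables of one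
  factor (\<open>comp_graph_relabel\<close>), and variables carry names throughout so that the renamings need
  not be tracked.
\<close>

section \<open>Gluing\<close>

abbreviation linked :: "graph \<Rightarrow> graph \<Rightarrow> (glued_var \<times> glued_var) set" where
  "linked g f \<equiv> {(a, b). {a, b} \<in> glued_edges g f}\<^sup>*"

lemma linked_sym: "(a, b) \<in> linked g f \<Longrightarrow> (b, a) \<in> linked g f"
proof -
  have "sym {(a, b). {a, b} \<in> glued_edges g f}"
    by (auto simp: sym_def insert_commute)
  then show "(a, b) \<in> linked g f \<Longrightarrow> (b, a) \<in> linked g f"
    by (meson sym_rtrancl symD)
qed

lemma linked_step: "{a, b} \<in> glued_edges g f \<Longrightarrow> (b, c) \<in> linked g f \<Longrightarrow> (a, c) \<in> linked g f"
  by (rule converse_rtrancl_into_rtrancl) auto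

section \<open>A three-valued model of allowable morphisms\<close>

text \<open>
  The relation between two points of a coherence space; \<open>Incoherent\<close> and \<open>Coherent\<close> are strict,
  that is, they are about distinct points.
\<close>
datatype coherence = Incoherent | Equal | Coherent

fun below :: "coherence \<Rightarrow> coherence \<Rightarrow> bool" where
  "below Incoherent b \<longleftrightarrow> True"
| "below Equal b \<longleftrightarrow> b \<noteq> Incoherent"
| "below Coherent b \<longleftrightarrow> b = Coherent"

text \<open>
  Pairs of points are coherent in a tensor product if both components are coherent or equal;
  with \<open>dual\<close> this is the three-element Sugihara monoid.
\<close>
fun fuse :: "coherence \<Rightarrow> coherence \<Rightarrow> coherence" where
  "fuse Incoherent b = Incoherent"
| "fuse Equal b = b"
| "fuse Coherent b = (if b = Incoherent then Incoherent else Coherent)"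

fun dual :: "coherence \<Rightarrow> coherence" where
  "dual Incoherent = Coherent"
| "dual Equal = Equal"
| "dual Coherent = Incoherent"

definition impl :: "coherence \<Rightarrow> coherence \<Rightarrow> coherence" where
  "impl a b = dual (fuse a (dual b))"

lemma below_refl: "below a a"
  by (cases a) auto

lemma below_trans: "below a b \<Longrightarrow> below b c \<Longrightarrow> below a c"
  by (cases a; cases b; cases c) auto

lemma fuse_assoc: "fuse (fuse a b) c = fuse a (fuse b c)"
  by (cases a; cases b; cases c) auto

lemma fuse_commute: "fuse a b = fuse b a"
  by (cases a; cases b) auto

lemma dual_dual: "dual (dual a) = a"
  by (cases a) auto

lemma fuse_Equal: "fuse a Equal = a"
  by (cases a) auto

lemma fuse_mono: "below a a' \<Longrightarrow> below b b' \<Longrightarrow> below (fuse a b) (fuse a' b')"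
  by (cases a; cases b; cases a'; cases b') auto

lemma impl_mono: "below a' a \<Longrightarrow> below b b' \<Longrightarrow> below (impl a b) (impl a' b')"
  by (cases a; cases b; cases a'; cases b') (auto simp: impl_def)

text \<open>Residuation: it makes the values a closed poset, which is what \<open>d\<close> and \<open>e\<close> need.\<close>
lemma below_impl_iff: "below a (impl b c) \<longleftrightarrow> below (fuse a b) c"
  by (cases a; cases b; cases c) (auto simp: impl_def)

fun factor_coherence :: "factor \<Rightarrow> (nat \<Rightarrow> coherence) \<Rightarrow> coherence"
  and shape_coherence :: "shape \<Rightarrow> (nat \<Rightarrow> coherence) \<Rightarrow> coherence" where
  "factor_coherence One w = w 0"
| "factor_coherence (Hom T S) w =
     impl (shape_coherence T w) (shape_coherence S (\<lambda>i. w (nv T + i)))"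
| "shape_coherence [] w = Equal"
| "shape_coherence (F # T) w =
     fuse (factor_coherence F w) (shape_coherence T (\<lambda>i. w (length (factor_vars F) + i)))"

lemma vars_Cons: "vars (F # T) = factor_vars F @ vars T"
  by (simp add: vars_def)

lemma factor_vars_Hom: "factor_vars (Hom T S) = map opp (vars T) @ vars S"
  by (simp add: vars_def)

lemma shape_coherence_cong_aux:
  "(\<forall>i < length (factor_vars F). w i = w' i) \<Longrightarrow> factor_coherence F w = factor_coherence F w'"
  "(\<forall>i < nv T. w i = w' i) \<Longrightarrow> shape_coherence T w = shape_coherence T w'"
proof (induction F w and T w arbitrary: w' and w' rule: factor_coherence_shape_coherence.induct)
  case (2 T S w)
  have "shape_coherence T w = shape_coherence T w'"
    using 2 by (auto simp: factor_vars_Hom simp del: factor_vars.simps)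
  moreover have "shape_coherence S (\<lambda>i. w (nv T + i)) = shape_coherence S (\<lambda>i. w' (nv T + i))"
    by (rule 2) (use 2(3) in \<open>auto simp: factor_vars_Hom simp del: factor_vars.simps\<close>)
  ultimately show ?case by simp
next
  case (4 F T w)
  have "factor_coherence F w = factor_coherence F w'"
    using 4 by (auto simp: vars_Cons)
  moreover have "shape_coherence T (\<lambda>i. w (length (factor_vars F) + i))
      = shape_coherence T (\<lambda>i. w' (length (factor_vars F) + i))"
    by (rule 4) (use 4(3) in \<open>auto simp: vars_Cons\<close>)
  ultimately show ?case by simp
qed auto

lemma shape_coherence_cong:
  "(\<And>i. i < nv T \<Longrightarrow> w i = w' i) \<Longrightarrow> shape_coherence T w = shape_coherence T w'"
  using shape_coherence_cong_aux(2) by blast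

lemma shape_coherence_tensor:
  "shape_coherence (tensor T S) w =
     fuse (shape_coherence T w) (shape_coherence S (\<lambda>i. w (nv T + i)))"
  by (induction T arbitrary: w) (auto simp: vars_Cons vars_simps(1) fuse_assoc add.assoc)

lemma shape_coherence_hom:
  "shape_coherence (hom_shape T S) w =
     impl (shape_coherence T w) (shape_coherence S (\<lambda>i. w (nv T + i)))"
  by (simp add: fuse_Equal)

definition constant_on_mates :: "'a set set \<Rightarrow> ('a \<Rightarrow> coherence) \<Rightarrow> bool" where
  "constant_on_mates f v \<longleftrightarrow> (\<forall>x y. {x, y} \<in> f \<longrightarrow> v x = v y)"

lemma constant_on_matesD: "constant_on_mates f v \<Longrightarrow> {x, y} \<in> f \<Longrightarrow> v x = v y"
  by (auto simp: constant_on_mates_def)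

lemma constant_on_mates_Un:
  "constant_on_mates (f \<union> g) v \<longleftrightarrow> constant_on_mates f v \<and> constant_on_mates g v"
  by (auto simp: constant_on_mates_def)

lemma constant_on_mates_image:
  "constant_on_mates ((image h) ` f) v \<Longrightarrow> constant_on_mates f (\<lambda>x. v (h x))"
  unfolding constant_on_mates_def by (metis image_empty image_insert imageI)

definition sound :: "shape \<Rightarrow> shape \<Rightarrow> graph \<Rightarrow> bool" where
  "sound T S f \<longleftrightarrow> (\<forall>v. constant_on_mates f v \<longrightarrow>
     below (shape_coherence T (\<lambda>i. v (Dom i))) (shape_coherence S (\<lambda>j. v (Cod j))))"

lemma soundD:
  "sound T S f \<Longrightarrow> constant_on_mates f v \<Longrightarrow>
     below (shape_coherence T (\<lambda>i. v (Dom i))) (shape_coherence S (\<lambda>j. v (Cod j)))"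
  by (auto simp: sound_def)

lemma sound_id: "sound T T (id_graph T)"
  unfolding sound_def
proof (intro allI impI)
  fix v assume v: "constant_on_mates (id_graph T) v"
  have "v (Dom i) = v (Cod i)" if "i < nv T" for i
    by (rule constant_on_matesD[OF v]) (use that in \<open>auto simp: id_graph_def\<close>)
  then have "shape_coherence T (\<lambda>i. v (Dom i)) = shape_coherence T (\<lambda>j. v (Cod j))"
    by (intro shape_coherence_cong) auto
  then show "below (shape_coherence T (\<lambda>i. v (Dom i))) (shape_coherence T (\<lambda>j. v (Cod j)))"
    by (simp add: below_refl)
qed

lemma sound_c: "sound (tensor T S) (tensor S T) (c_graph T S)"
  unfolding sound_def
proof (intro allI impI)
  fix v assume v: "constant_on_mates (c_graph T S) v"
  have "v (Dom i) = v (Cod (nv S + i))" if "i < nv T" for i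
    by (rule constant_on_matesD[OF v]) (use that in \<open>auto simp: c_graph_def\<close>)
  then have T: "shape_coherence T (\<lambda>i. v (Dom i)) = shape_coherence T (\<lambda>i. v (Cod (nv S + i)))"
    by (intro shape_coherence_cong) auto
  have "v (Dom (nv T + i)) = v (Cod i)" if "i < nv S" for i
    by (rule constant_on_matesD[OF v]) (use that in \<open>auto simp: c_graph_def\<close>)
  then have S: "shape_coherence S (\<lambda>i. v (Dom (nv T + i))) = shape_coherence S (\<lambda>i. v (Cod i))"
    by (intro shape_coherence_cong) auto
  show "below (shape_coherence (tensor T S) (\<lambda>i. v (Dom i)))
      (shape_coherence (tensor S T) (\<lambda>j. v (Cod j)))"
    by (simp add: shape_coherence_tensor T S fuse_commute below_refl)
qed

lemma sound_d: "sound T (hom_shape S (tensor T S)) (d_graph T S)"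
  unfolding sound_def
proof (intro allI impI)
  fix v assume v: "constant_on_mates (d_graph T S) v"
  have "v (Dom i) = v (Cod (nv S + i))" if "i < nv T" for i
    by (rule constant_on_matesD[OF v]) (use that in \<open>auto simp: d_graph_def\<close>)
  then have T: "shape_coherence T (\<lambda>i. v (Dom i)) = shape_coherence T (\<lambda>i. v (Cod (nv S + i)))"
    by (intro shape_coherence_cong) auto
  have "v (Cod i) = v (Cod (nv S + nv T + i))" if "i < nv S" for i
    by (rule constant_on_matesD[OF v]) (use that in \<open>auto simp: d_graph_def\<close>)
  then have S: "shape_coherence S (\<lambda>i. v (Cod i)) =
      shape_coherence S (\<lambda>i. v (Cod (nv S + nv T + i)))"
    by (intro shape_coherence_cong) auto
  show "below (shape_coherence T (\<lambda>i. v (Dom i)))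
      (shape_coherence (hom_shape S (tensor T S)) (\<lambda>j. v (Cod j)))"
    unfolding shape_coherence_hom shape_coherence_tensor below_impl_iff
    by (simp add: T S below_refl add.assoc)
qed

lemma sound_e: "sound (tensor (hom_shape T S) T) S (e_graph T S)"
  unfolding sound_def
proof (intro allI impI)
  fix v assume v: "constant_on_mates (e_graph T S) v"
  have "v (Dom i) = v (Dom (nv T + nv S + i))" if "i < nv T" for i
    by (rule constant_on_matesD[OF v]) (use that in \<open>auto simp: e_graph_def\<close>)
  then have T: "shape_coherence T (\<lambda>i. v (Dom (nv T + nv S + i))) = shape_coherence T (\<lambda>i. v (Dom i))"
    by (intro shape_coherence_cong) auto
  have "v (Dom (nv T + i)) = v (Cod i)" if "i < nv S" for i
    by (rule constant_on_matesD[OF v]) (use that in \<open>auto simp: e_graph_def\<close>)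
  then have S: "shape_coherence S (\<lambda>i. v (Dom (nv T + i))) = shape_coherence S (\<lambda>i. v (Cod i))"
    by (intro shape_coherence_cong) auto
  have "nv (hom_shape T S) = nv T + nv S"
    by (simp add: vars_simps)
  then show "below (shape_coherence (tensor (hom_shape T S) T) (\<lambda>i. v (Dom i)))
      (shape_coherence S (\<lambda>j. v (Cod j)))"
    unfolding shape_coherence_tensor shape_coherence_hom
    by (simp add: T S below_impl_iff[symmetric] below_refl)
qed

lemma sound_tensor:
  assumes "sound T T' f" "sound S S' g"
  shows "sound (tensor T S) (tensor T' S') (tensor_graph T T' f g)"
  unfolding sound_def
proof (intro allI impI)
  fix v assume "constant_on_mates (tensor_graph T T' f g) v"
  then have "constant_on_mates f v" "constant_on_mates g (\<lambda>x. v (shift (nv T) (nv T') x))"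
    by (auto simp: tensor_graph_def constant_on_mates_Un constant_on_mates_image)
  from soundD[OF assms(1) this(1)] soundD[OF assms(2) this(2)]
  show "below (shape_coherence (tensor T S) (\<lambda>i. v (Dom i)))
      (shape_coherence (tensor T' S') (\<lambda>j. v (Cod j)))"
    by (simp add: shape_coherence_tensor fuse_mono)
qed

lemma sound_hom:
  assumes "sound T T' f" "sound S S' g"
  shows "sound (hom_shape T' S) (hom_shape T S') (hom_graph T T' f g)"
  unfolding sound_def
proof (intro allI impI)
  fix v assume "constant_on_mates (hom_graph T T' f g) v"
  then have "constant_on_mates f (\<lambda>x. v (swap_side x))"
    "constant_on_mates g (\<lambda>x. v (shift (nv T') (nv T) x))"
    by (auto simp: hom_graph_def constant_on_mates_Un constant_on_mates_image)
  from soundD[OF assms(1) this(1)] soundD[OF assms(2) this(2)]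
  show "below (shape_coherence (hom_shape T' S) (\<lambda>i. v (Dom i)))
      (shape_coherence (hom_shape T S') (\<lambda>j. v (Cod j)))"
    by (simp add: shape_coherence_hom impl_mono del: shape_coherence.simps)
qed

text \<open>
  A variable of the middle shape takes the value of any outer variable on its path. The choice does
  not matter since outer variables on one path are mates in the composite; a closed loop meets
  no outer variable and gets an arbitrary constant value.
\<close>
lemma comp_graph_valuation_extends:
  assumes v: "constant_on_mates (comp_graph g f) v"
  obtains w where "\<And>x. w (glue_outer x) = v x" "constant_on_mates (glued_edges g f) w"
proof
  define w where "w a = (if \<exists>x. (a, glue_outer x) \<in> linked g f
      then v (SOME x. (a, glue_outer x) \<in> linked g f) else Equal)" for a
  have w: "w a = v x" if "(a, glue_outer x) \<in> linked g f" for a x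
  proof -
    define y where "y = (SOME x. (a, glue_outer x) \<in> linked g f)"
    have y: "(a, glue_outer y) \<in> linked g f"
      unfolding y_def using that by (rule someI)
    have "(glue_outer y, glue_outer x) \<in> linked g f"
      using linked_sym[OF y] that by (rule rtrancl_trans)
    then have "y \<noteq> x \<Longrightarrow> {y, x} \<in> comp_graph g f"
      by (auto simp: comp_graph_def)
    then have "v y = v x"
      using constant_on_matesD[OF v] by blast
    then show ?thesis
      using that by (auto simp: w_def y_def)
  qed
  show "w (glue_outer x) = v x" for x
    by (rule w) simp
  show "constant_on_mates (glued_edges g f) w"
    unfolding constant_on_mates_def
  proof (intro allI impI)
    fix a b assume "{a, b} \<in> glued_edges g f"
    then have ab: "(a, b) \<in> linked g f" by auto
    show "w a = w b"
    proof (cases "\<exists>x. (b, glue_outer x) \<in> linked g f")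
      case True
      then obtain x where x: "(b, glue_outer x) \<in> linked g f" by auto
      with ab have "(a, glue_outer x) \<in> linked g f" by (rule rtrancl_trans)
      with x show ?thesis by (simp add: w)
    next
      case False
      moreover have "\<nexists>x. (a, glue_outer x) \<in> linked g f"
        using False linked_sym[OF ab] by (meson rtrancl_trans)
      ultimately show ?thesis by (simp add: w_def)
    qed
  qed
qed

lemma sound_comp:
  assumes "sound T S f" "sound S R g"
  shows "sound T R (comp_graph g f)"
  unfolding sound_def
proof (intro allI impI)
  fix v assume "constant_on_mates (comp_graph g f) v"
  then obtain w where w: "\<And>x. w (glue_outer x) = v x" "constant_on_mates (glued_edges g f) w"
    using comp_graph_valuation_extends by blast
  have "w (Src i) = v (Dom i)" "w (Tgt i) = v (Cod i)" for i
    using w(1)[of "Dom i"] w(1)[of "Cod i"] by auto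
  moreover have "constant_on_mates f (\<lambda>x. w (glue_first x))"
    "constant_on_mates g (\<lambda>x. w (glue_second x))"
    using w(2) by (auto simp: glued_edges_def constant_on_mates_Un constant_on_mates_image)
  ultimately show "below (shape_coherence T (\<lambda>i. v (Dom i))) (shape_coherence R (\<lambda>j. v (Cod j)))"
    using soundD[OF assms(1), of "\<lambda>x. w (glue_first x)"]
      soundD[OF assms(2), of "\<lambda>x. w (glue_second x)"]
    by (auto intro: below_trans)
qed

lemma allowable_sound: "allowable T S f \<Longrightarrow> sound T S f"
  by (induction rule: allowable.induct)
    (simp_all only: sound_id sound_c sound_d sound_e sound_tensor sound_hom sound_comp)

section \<open>Composites that rename the variables of one factor\<close>

text \<open>
  A partial pairing of the variables in \<open>V\<close>. It keeps what the computation of composites uses of a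
  graph, and passes to images under injections without reference to signs.
\<close>
definition linking :: "'a set \<Rightarrow> 'a set set \<Rightarrow> bool" where
  "linking V f \<longleftrightarrow> \<Union>f \<subseteq> V \<and> (\<forall>e\<in>f. card e = 2) \<and> disjoint f"

lemma linking_image:
  assumes "linking V f" "inj_on h V" "h ` V \<subseteq> W"
  shows "linking W ((image h) ` f)"
proof -
  have sub: "e \<subseteq> V" if "e \<in> f" for e
    using assms(1) that by (auto simp: linking_def)
  have "card (h ` e) = 2" if "e \<in> f" for e
    using assms(1) sub[OF that] that inj_on_subset[OF assms(2)]
    by (auto simp: linking_def card_image)
  moreover have "disjoint ((image h) ` f)"
    using assms(1) disjoint_image[of h f] assms(2)
    by (auto simp: linking_def intro: inj_on_subset)
  moreover have "\<Union>((image h) ` f) \<subseteq> W"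
    using sub assms(3) by blast
  ultimately show ?thesis by (auto simp: linking_def)
qed

lemma linking_Un:
  assumes "linking V f" "linking W g" "V \<inter> W = {}"
  shows "linking (V \<union> W) (f \<union> g)"
  unfolding linking_def
proof (intro conjI)
  show "disjoint (f \<union> g)"
    using assms by (intro disjoint_union) (auto simp: linking_def)
qed (use assms in \<open>auto simp: linking_def\<close>)

lemma linking_mono: "linking V f \<Longrightarrow> V \<subseteq> W \<Longrightarrow> linking W f"
  by (auto simp: linking_def)

lemma linkingE:
  assumes "linking V f" "e \<in> f"
  obtains x y where "e = {x, y}" "x \<noteq> y" "x \<in> V" "y \<in> V"
proof -
  have "card e = 2" "e \<subseteq> V"
    using assms by (auto simp: linking_def)
  then show thesis
    using that by (auto simp: card_2_iff)
qed

lemma linking_id: "linking (variables T T) (id_graph T)"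
  unfolding linking_def
proof (intro conjI)
  show "disjoint (id_graph T)"
    by (auto simp: disjoint_def id_graph_def)
qed (auto simp: id_graph_def variables_def)

text \<open>
  One factor of the composition contributes the edges \<open>\<alpha> ` e\<close> of \<open>f\<close>, and the remaining edges \<open>E\<close>
  only transport variables: \<open>\<psi>\<close> sends each glued variable to the outer variable to which \<open>E\<close>
  carries it. Contracting \<open>E\<close> therefore leaves \<open>f\<close>, with its variables renamed.
\<close>
lemma comp_graph_relabel:
  assumes f: "linking V f" and inj: "inj_on \<phi> V"
    and glued: "glued_edges g g' = (image \<alpha>) ` f \<union> E"
    and outer: "\<And>x. \<psi> (glue_outer x) = x"
    and old: "\<And>x. x \<in> V \<Longrightarrow> \<psi> (\<alpha> x) = \<phi> x"
    and new: "\<And>a b. {a, b} \<in> E \<Longrightarrow> \<psi> a = \<psi> b"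
    and path: "\<And>x. x \<in> V \<Longrightarrow> (glue_outer (\<phi> x), \<alpha> x) \<in> linked g g'"
  shows "comp_graph g g' = (image \<phi>) ` f"
proof
  define h where "h = (image \<phi>) ` f"
  have h: "linking (\<phi> ` V) h"
    unfolding h_def using f inj by (rule linking_image) simp
  have edge: "\<psi> a = \<psi> b \<or> {\<psi> a, \<psi> b} \<in> h" if ab: "{a, b} \<in> glued_edges g g'" for a b
  proof -
    consider "{a, b} \<in> E" | e where "e \<in> f" "{a, b} = \<alpha> ` e"
      using ab unfolding glued by blast
    then show ?thesis
    proof cases
      case 2
      have "\<psi> ` {a, b} = \<phi> ` e"
        unfolding 2(2) image_image using f 2(1) old by (intro image_cong) (auto simp: linking_def)
      then have "{\<psi> a, \<psi> b} = \<phi> ` e" by simp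
      then show ?thesis using 2(1) by (simp add: h_def)
    qed (use new in blast)
  qed
  have unique: "x = y" if "{u, x} \<in> h" "{u, y} \<in> h" for u x y
  proof -
    have "disjoint h" using h by (simp add: linking_def)
    from disjointD[OF this that] have "{u, x} = {u, y}" by fastforce
    then show "x = y" by (auto simp: doubleton_eq_iff)
  qed
  \<comment> \<open>A path stays at one outer variable or at the two ends of one renamed edge of \<open>f\<close>.\<close>
  have walk: "\<psi> a = \<psi> b \<or> {\<psi> a, \<psi> b} \<in> h" if "(a, b) \<in> linked g g'" for a b
    using that
  proof (induction rule: rtrancl_induct)
    case (step b c)
    then have bc: "\<psi> b = \<psi> c \<or> {\<psi> b, \<psi> c} \<in> h"
      using edge by auto
    show ?case
    proof (cases "\<psi> a = \<psi> b \<or> \<psi> b = \<psi> c")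
      case False
      then have "{\<psi> b, \<psi> a} \<in> h" "{\<psi> b, \<psi> c} \<in> h"
        using bc step.IH by (auto simp: insert_commute)
      then show ?thesis using unique[of "\<psi> b" "\<psi> a" "\<psi> c"] by simp
    qed (use bc step.IH in auto)
  qed simp
  show "comp_graph g g' \<subseteq> (image \<phi>) ` f"
  proof
    fix e assume "e \<in> comp_graph g g'"
    then obtain x y where e: "e = {x, y}" "x \<noteq> y" "(glue_outer x, glue_outer y) \<in> linked g g'"
      by (auto simp: comp_graph_def)
    have "{x, y} \<in> h"
      using walk[OF e(3)] e(2) unfolding outer by simp
    then show "e \<in> (image \<phi>) ` f"
      unfolding e(1) h_def .
  qed
  show "(image \<phi>) ` f \<subseteq> comp_graph g g'"
  proof
    fix e' assume "e' \<in> (image \<phi>) ` f"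
    then obtain e where e: "e \<in> f" "e' = \<phi> ` e" by blast
    obtain x y where xy: "e = {x, y}" "x \<noteq> y" "x \<in> V" "y \<in> V"
      using linkingE[OF f e(1)] .
    have "\<alpha> ` e \<in> glued_edges g g'"
      unfolding glued using e(1) by simp
    then have "(\<alpha> x, \<alpha> y) \<in> linked g g'" by (auto simp: xy(1))
    then have "(glue_outer (\<phi> x), glue_outer (\<phi> y)) \<in> linked g g'"
      by (rule rtrancl_trans[OF path[OF xy(3)] rtrancl_trans[OF _ linked_sym[OF path[OF xy(4)]]]])
    moreover have "\<phi> x \<noteq> \<phi> y" using inj xy by (auto simp: inj_on_def)
    ultimately show "e' \<in> comp_graph g g'"
      unfolding comp_graph_def e(2) xy(1) image_insert image_empty mem_Collect_eq by blast
  qed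
qed

fun uncurry_var :: "shape \<Rightarrow> shape \<Rightarrow> var \<Rightarrow> var" where
  "uncurry_var P Q (Dom i) = Dom i"
| "uncurry_var P Q (Cod j) = (if j < nv Q then Dom (nv P + j) else Cod (j - nv Q))"

text \<open>
  The variables of \<open>Q\<close> inside \<open>[Q, R]\<close> reach the outside in two steps: evaluation sends them to the
  second copy of \<open>Q\<close> in the middle, which the identity sends to the domain.
\<close>
lemma comp_uncurry:
  assumes f: "linking (variables P (hom_shape Q R)) f"
  shows "comp_graph (e_graph Q R) (tensor_graph P (hom_shape Q R) f (id_graph Q))
    = (image (uncurry_var P Q)) ` f"
proof -
  let ?g = "e_graph Q R" and ?g' = "tensor_graph P (hom_shape Q R) f (id_graph Q)"
  let ?p = "nv P" and ?q = "nv Q" and ?r = "nv R"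
  let ?E = "{{Src (?p + i), Mid (?q + ?r + i)} | i. i < ?q}
    \<union> {{Mid i, Mid (?q + ?r + i)} | i. i < ?q} \<union> {{Mid (?q + j), Tgt j} | j. j < ?r}"
  let ?\<psi> = "\<lambda>a. case a of Src i \<Rightarrow> Dom i | Tgt j \<Rightarrow> Cod j
    | Mid i \<Rightarrow> if i < ?q then Dom (?p + i) else if i < ?q + ?r then Cod (i - ?q)
        else Dom (?p + (i - (?q + ?r)))"
  have hom: "nv (hom_shape Q R) = ?q + ?r" by (simp add: vars_simps)
  have glued: "glued_edges ?g ?g' = (image glue_first) ` f \<union> ?E"
    unfolding glued_edges_def tensor_graph_def id_graph_def e_graph_def hom
    by (simp add: image_Un setcompr_eq_image image_image Un_assoc)
  show ?thesis
  proof (rule comp_graph_relabel[where \<psi> = ?\<psi> and E = ?E, OF f _ glued])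
    show "inj_on (uncurry_var P Q) (variables P (hom_shape Q R))"
      unfolding inj_on_def variables_def hom by (auto split: if_splits)
  next
    fix x show "?\<psi> (glue_outer x) = x" by (cases x) auto
  next
    fix x assume "x \<in> variables P (hom_shape Q R)"
    then show "?\<psi> (glue_first x) = uncurry_var P Q x"
      unfolding variables_def hom by auto
  next
    fix a b assume "{a, b} \<in> ?E"
    then show "?\<psi> a = ?\<psi> b" by (auto simp: doubleton_eq_iff)
  next
    fix x assume x: "x \<in> variables P (hom_shape Q R)"
    show "(glue_outer (uncurry_var P Q x), glue_first x) \<in> linked ?g ?g'"
    proof (cases x)
      case (Cod j)
      show ?thesis
      proof (cases "j < ?q")
        case True
        have "{Src (?p + j), Mid (?q + ?r + j)} \<in> glued_edges ?g ?g'"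
          "{Mid (?q + ?r + j), Mid j} \<in> glued_edges ?g ?g'"
          unfolding glued using True by (auto simp: insert_commute)
        then show ?thesis using True Cod
          by (auto intro: linked_step)
      next
        case False
        then have "j - ?q < ?r" using x Cod by (auto simp: variables_def hom)
        then have "{Mid (?q + (j - ?q)), Tgt (j - ?q)} \<in> glued_edges ?g ?g'"
          unfolding glued by blast
        then show ?thesis using False Cod
          by (auto simp: insert_commute)
      qed
    qed simp
  qed
qed

fun curry_var :: "shape \<Rightarrow> shape \<Rightarrow> var \<Rightarrow> var" where
  "curry_var P Q (Dom i) = (if i < nv P then Dom i else Cod (i - nv P))"
| "curry_var P Q (Cod j) = Cod (nv Q + j)"

text \<open>
  The two steps out of the middle are now taken by the second copy of \<open>Q\<close>, through coevaluation
  and then the identity.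
\<close>
lemma comp_curry:
  assumes f: "linking (variables (tensor P Q) R) f"
  shows "comp_graph (hom_graph Q Q (id_graph Q) f) (d_graph P Q)
    = (image (curry_var P Q)) ` f"
proof -
  let ?g = "hom_graph Q Q (id_graph Q) f" and ?g' = "d_graph P Q"
  let ?p = "nv P" and ?q = "nv Q" and ?r = "nv R"
  let ?E = "{{Src i, Mid (?q + i)} | i. i < ?p}
    \<union> {{Mid i, Mid (?q + ?p + i)} | i. i < ?q} \<union> {{Tgt j, Mid j} | j. j < ?q}"
  let ?\<psi> = "\<lambda>a. case a of Src i \<Rightarrow> Dom i | Tgt j \<Rightarrow> Cod j
    | Mid i \<Rightarrow> if i < ?q then Cod i else if i < ?q + ?p then Dom (i - ?q)
        else Cod (i - (?q + ?p))"
  let ?\<alpha> = "\<lambda>x. glue_second (shift ?q ?q x)"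
  have glued: "glued_edges ?g ?g' = (image ?\<alpha>) ` f \<union> ?E"
    unfolding glued_edges_def hom_graph_def id_graph_def d_graph_def
    by (simp add: image_Un setcompr_eq_image image_image Un_ac)
  show ?thesis
  proof (rule comp_graph_relabel[where \<psi> = ?\<psi> and E = ?E, OF f _ glued])
    show "inj_on (curry_var P Q) (variables (tensor P Q) R)"
      unfolding inj_on_def variables_def vars_simps by (auto split: if_splits)
  next
    fix x show "?\<psi> (glue_outer x) = x" by (cases x) auto
  next
    fix x assume "x \<in> variables (tensor P Q) R"
    then show "?\<psi> (?\<alpha> x) = curry_var P Q x"
      unfolding variables_def vars_simps by auto
  next
    fix a b assume "{a, b} \<in> ?E"
    then show "?\<psi> a = ?\<psi> b" by (auto simp: doubleton_eq_iff)
  next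
    fix x assume x: "x \<in> variables (tensor P Q) R"
    show "(glue_outer (curry_var P Q x), ?\<alpha> x) \<in> linked ?g ?g'"
    proof (cases x)
      case (Dom i)
      show ?thesis
      proof (cases "i < ?p")
        case True
        then have "{Src i, Mid (?q + i)} \<in> glued_edges ?g ?g'"
          unfolding glued by auto
        then show ?thesis using True Dom by auto
      next
        case False
        then have "i - ?p < ?q" and i: "?q + ?p + (i - ?p) = ?q + i"
          using x Dom by (auto simp: variables_def vars_simps)
        then have "{Tgt (i - ?p), Mid (i - ?p)} \<in> glued_edges ?g ?g'"
          "{Mid (i - ?p), Mid (?q + ?p + (i - ?p))} \<in> glued_edges ?g ?g'"
          unfolding glued by (auto simp: insert_commute)
        then show ?thesis using False Dom i
          by (auto intro: linked_step)
      qed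
    qed simp
  qed
qed

fun swap_var :: "shape \<Rightarrow> shape \<Rightarrow> var \<Rightarrow> var" where
  "swap_var T S (Dom i) =
     (if i < nv S then Dom (nv T + i) else if i < nv S + nv T then Dom (i - nv S) else Dom i)"
| "swap_var T S (Cod j) = Cod j"

lemma comp_swap:
  assumes f: "linking (variables (tensor (tensor S T) U) R) f"
  shows "comp_graph f (tensor_graph (tensor T S) (tensor S T) (c_graph T S) (id_graph U))
    = (image (swap_var T S)) ` f"
proof -
  let ?g = "f" and ?g' = "tensor_graph (tensor T S) (tensor S T) (c_graph T S) (id_graph U)"
  let ?t = "nv T" and ?s = "nv S" and ?u = "nv U"
  let ?E = "{{Src i, Mid (?s + i)} | i. i < ?t} \<union> {{Src (?t + i), Mid i} | i. i < ?s}
    \<union> {{Src (?s + ?t + j), Mid (?s + ?t + j)} | j. j < ?u}"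
  let ?\<psi> = "\<lambda>a. case a of Src i \<Rightarrow> Dom i | Tgt j \<Rightarrow> Cod j | Mid i \<Rightarrow> swap_var T S (Dom i)"
  have glued: "glued_edges ?g ?g' = (image glue_second) ` f \<union> ?E"
    unfolding glued_edges_def tensor_graph_def id_graph_def c_graph_def
    by (simp add: image_Un setcompr_eq_image image_image vars_simps Un_ac add.commute)
  have edge: "{Src (if i < ?s then ?t + i else if i < ?s + ?t then i - ?s else i), Mid i}
      \<in> glued_edges ?g ?g'" if "i < ?s + ?t + ?u" for i
  proof -
    have "i < ?s \<or> (\<exists>j<?t. i = ?s + j) \<or> (\<exists>j<?u. i = ?s + ?t + j)"
      using that by presburger
    then show ?thesis
      unfolding glued by (elim disjE exE conjE) auto
  qed
  show ?thesis
  proof (rule comp_graph_relabel[where \<psi> = ?\<psi> and E = ?E, OF f _ glued])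
    show "inj_on (swap_var T S) (variables (tensor (tensor S T) U) R)"
      unfolding inj_on_def variables_def vars_simps by (auto split: if_splits)
  next
    fix x show "?\<psi> (glue_outer x) = x" by (cases x) auto
  next
    fix x assume "x \<in> variables (tensor (tensor S T) U) R"
    then show "?\<psi> (glue_second x) = swap_var T S x"
      by (cases x) auto
  next
    fix a b assume "{a, b} \<in> ?E"
    then show "?\<psi> a = ?\<psi> b" by (auto simp: doubleton_eq_iff)
  next
    fix x assume x: "x \<in> variables (tensor (tensor S T) U) R"
    show "(glue_outer (swap_var T S x), glue_second x) \<in> linked ?g ?g'"
    proof (cases x)
      case (Dom i)
      then have "i < ?s + ?t + ?u"
        using x by (auto simp: variables_def vars_simps)
      from edge[OF this] show ?thesis
        using Dom by auto
    qed simp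
  qed
qed

section \<open>Allowable morphisms with named variables\<close>

fun label :: "'n list \<Rightarrow> 'n list \<Rightarrow> var \<Rightarrow> 'n" where
  "label L K (Dom i) = L ! i"
| "label L K (Cod j) = K ! j"

text \<open>
  The variables of \<open>T\<close> and \<open>S\<close> are given names, and \<open>M\<close> is the pairing of the names.
  Rules that move a variable between positions or sides then keep \<open>M\<close> fixed.
\<close>
definition derivable :: "shape \<Rightarrow> 'n list \<Rightarrow> shape \<Rightarrow> 'n list \<Rightarrow> 'n set set \<Rightarrow> bool" where
  "derivable T L S K M \<longleftrightarrow> length L = nv T \<and> length K = nv S \<and>
     (\<exists>f. allowable T S f \<and> linking (variables T S) f \<and> M = (image (label L K)) ` f)"

lemma image_image_cong:
  assumes "linking V f" "\<And>x. x \<in> V \<Longrightarrow> h (\<phi> x) = h' x"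
  shows "(image h) ` ((image \<phi>) ` f) = (image h') ` f"
proof -
  have "h ` \<phi> ` e = h' ` e" if "e \<in> f" for e
    unfolding image_image using assms that by (intro image_cong) (auto simp: linking_def)
  then show ?thesis by (simp add: image_image)
qed

lemma derivable_relabel:
  assumes f: "linking (variables T S) f" "inj_on \<phi> (variables T S)"
    "\<phi> ` variables T S \<subseteq> variables T' S'"
    and M: "M = (image (label L K)) ` f"
    and all: "allowable T' S' f'" "f' = (image \<phi>) ` f"
    and len: "length L' = nv T'" "length K' = nv S'"
    and lab: "\<And>x. x \<in> variables T S \<Longrightarrow> label L' K' (\<phi> x) = label L K x"
  shows "derivable T' L' S' K' M"
  unfolding derivable_def
proof (intro conjI exI[of _ f'])
  show "linking (variables T' S') f'"
    unfolding all(2) using f by (rule linking_image)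
  show "M = (image (label L' K')) ` f'"
    unfolding all(2) M using f(1) lab by (rule image_image_cong[symmetric])
qed (use all(1) len in simp_all)

lemma derivable_uncurry:
  assumes "derivable P L (hom_shape Q R) (K @ K') M" "length K = nv Q"
  shows "derivable (tensor P Q) (L @ K) R K' M"
proof -
  obtain f where f: "allowable P (hom_shape Q R) f" "linking (variables P (hom_shape Q R)) f"
    "M = (image (label L (K @ K'))) ` f" and len: "length L = nv P" "length K' = nv R"
    using assms by (auto simp: derivable_def vars_simps)
  have hom: "nv (hom_shape Q R) = nv Q + nv R" by (simp add: vars_simps)
  have allow: "allowable (tensor P Q) R
      (comp_graph (e_graph Q R) (tensor_graph P (hom_shape Q R) f (id_graph Q)))"
    using f(1) by (intro allowable_comp[OF allowable_tensor[OF _ allowable_id] allowable_e])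
  show ?thesis
  proof (rule derivable_relabel[OF f(2) _ _ f(3) allow comp_uncurry[OF f(2)]])
    show "inj_on (uncurry_var P Q) (variables P (hom_shape Q R))"
      unfolding inj_on_def variables_def hom by (auto split: if_splits)
    show "uncurry_var P Q ` variables P (hom_shape Q R) \<subseteq> variables (tensor P Q) R"
      unfolding variables_def hom by (auto simp: vars_simps)
    show "label (L @ K) K' (uncurry_var P Q x) = label L (K @ K') x"
      if "x \<in> variables P (hom_shape Q R)" for x
      using that len assms(2) unfolding variables_def hom by (auto simp: nth_append)
  qed (use len assms(2) in \<open>auto simp: vars_simps\<close>)
qed

lemma derivable_curry:
  assumes "derivable (tensor P Q) (L @ L') R K M" "length L = nv P"
  shows "derivable P L (hom_shape Q R) (L' @ K) M"
proof -
  obtain f where f: "allowable (tensor P Q) R f" "linking (variables (tensor P Q) R) f"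
    "M = (image (label (L @ L') K)) ` f" and len: "length L' = nv Q" "length K = nv R"
    using assms by (auto simp: derivable_def vars_simps)
  have allow: "allowable P (hom_shape Q R)
      (comp_graph (hom_graph Q Q (id_graph Q) f) (d_graph P Q))"
    using f(1) by (intro allowable_comp[OF allowable_d allowable_hom[OF allowable_id]])
  show ?thesis
  proof (rule derivable_relabel[OF f(2) _ _ f(3) allow comp_curry[OF f(2)]])
    show "inj_on (curry_var P Q) (variables (tensor P Q) R)"
      unfolding inj_on_def variables_def vars_simps by (auto split: if_splits)
    show "curry_var P Q ` variables (tensor P Q) R \<subseteq> variables P (hom_shape Q R)"
      unfolding variables_def by (auto simp: vars_simps)
    show "label L (L' @ K) (curry_var P Q x) = label (L @ L') K x"
      if "x \<in> variables (tensor P Q) R" for x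
      using that len assms(2) unfolding variables_def by (auto simp: nth_append vars_simps)
  qed (use len assms(2) in \<open>auto simp: vars_simps\<close>)
qed

lemma derivable_swap:
  assumes "derivable (tensor (tensor S T) U) (K @ L @ J) R N M" "length K = nv S" "length L = nv T"
  shows "derivable (tensor (tensor T S) U) (L @ K @ J) R N M"
proof -
  obtain f where f: "allowable (tensor (tensor S T) U) R f"
    "linking (variables (tensor (tensor S T) U) R) f"
    "M = (image (label (K @ L @ J) N)) ` f" and len: "length J = nv U" "length N = nv R"
    using assms by (auto simp: derivable_def vars_simps)
  have allow: "allowable (tensor (tensor T S) U) R
      (comp_graph f (tensor_graph (tensor T S) (tensor S T) (c_graph T S) (id_graph U)))"
    using f(1) by (intro allowable_comp[OF allowable_tensor[OF allowable_c allowable_id]])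
  show ?thesis
  proof (rule derivable_relabel[OF f(2) _ _ f(3) allow comp_swap[OF f(2)]])
    show "inj_on (swap_var T S) (variables (tensor (tensor S T) U) R)"
      unfolding inj_on_def variables_def vars_simps by (auto split: if_splits)
    show "swap_var T S ` variables (tensor (tensor S T) U) R
        \<subseteq> variables (tensor (tensor T S) U) R"
      unfolding variables_def by (auto simp: vars_simps)
    show "label (L @ K @ J) N (swap_var T S x) = label (K @ L @ J) N x"
      if "x \<in> variables (tensor (tensor S T) U) R" for x
      using that len assms(2,3) unfolding variables_def
      by (auto simp: nth_append vars_simps add.commute)
  qed (use len assms in \<open>auto simp: vars_simps\<close>)
qed

lemma derivable_tensor:
  assumes "derivable T L T' L' M" "derivable S K S' K' N"
  shows "derivable (tensor T S) (L @ K) (tensor T' S') (L' @ K') (M \<union> N)"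
proof -
  obtain f where f: "allowable T T' f" "linking (variables T T') f"
    "M = (image (label L L')) ` f" and len: "length L = nv T" "length L' = nv T'"
    using assms(1) by (auto simp: derivable_def)
  obtain g where g: "allowable S S' g" "linking (variables S S') g"
    "N = (image (label K K')) ` g" and len': "length K = nv S" "length K' = nv S'"
    using assms(2) by (auto simp: derivable_def)
  let ?h = "shift (nv T) (nv T')"
  have "linking (?h ` variables S S') ((image ?h) ` g)"
    using g(2) by (rule linking_image) (auto simp: inj_on_def variables_def)
  moreover have "variables T T' \<inter> ?h ` variables S S' = {}"
    by (auto simp: variables_def)
  moreover have "variables T T' \<union> ?h ` variables S S' \<subseteq> variables (tensor T S) (tensor T' S')"
    by (auto simp: variables_def vars_simps)
  ultimately have "linking (variables (tensor T S) (tensor T' S')) (tensor_graph T T' f g)"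
    unfolding tensor_graph_def by (meson linking_mono linking_Un f(2))
  moreover have "(image (label (L @ K) (L' @ K'))) ` f = M"
  proof -
    have "label (L @ K) (L' @ K') (id x) = label L L' x" if "x \<in> variables T T'" for x
      using that len by (auto simp: variables_def nth_append)
    then have "(image (label (L @ K) (L' @ K'))) ` ((image id) ` f) = M"
      unfolding f(3) by (rule image_image_cong[OF f(2)])
    then show ?thesis by simp
  qed
  moreover have "(image (label (L @ K) (L' @ K'))) ` ((image ?h) ` g) = N"
    unfolding g(3) by (rule image_image_cong[OF g(2)]) (auto simp: variables_def nth_append len)
  ultimately show ?thesis
    unfolding derivable_def using allowable_tensor[OF f(1) g(1)] len len'
    by (auto simp: vars_simps tensor_graph_def image_Un intro!: exI[of _ "tensor_graph T T' f g"])
qed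

lemma derivable_axiom: "derivable one_shape [a] one_shape [b] {{a, b}}"
  unfolding derivable_def
  by (intro conjI exI[of _ "id_graph one_shape"] allowable_id linking_id)
    (auto simp: vars_simps id_graph_def)

text \<open>The functor \<open>[-, 1]\<close> applied to a morphism; \<open>a\<close> and \<open>b\<close> name the two copies of \<open>1\<close>.\<close>
lemma derivable_hom_one:
  assumes "derivable T L S K M"
  shows "derivable (hom_shape S one_shape) (K @ [a]) (hom_shape T one_shape) (L @ [b])
    (insert {a, b} M)"
proof -
  obtain f where f: "allowable T S f" "linking (variables T S) f"
    "M = (image (label L K)) ` f" and len: "length L = nv T" "length K = nv S"
    using assms by (auto simp: derivable_def)
  let ?h = "shift (nv S) (nv T)" and ?one = "id_graph one_shape"
  let ?f = "hom_graph T S f ?one"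
  have "linking (swap_side ` variables T S) ((image swap_side) ` f)"
    using f(2) by (rule linking_image) (auto simp: inj_on_def variables_def)
  moreover have "linking (?h ` variables one_shape one_shape) ((image ?h) ` ?one)"
    using linking_id by (rule linking_image) (auto simp: inj_on_def variables_def)
  moreover have "swap_side ` variables T S \<inter> ?h ` variables one_shape one_shape = {}"
    by (auto simp: variables_def)
  moreover have "swap_side ` variables T S \<union> ?h ` variables one_shape one_shape
      \<subseteq> variables (hom_shape S one_shape) (hom_shape T one_shape)"
    by (auto simp: variables_def vars_simps)
  ultimately have "linking (variables (hom_shape S one_shape) (hom_shape T one_shape)) ?f"
    unfolding hom_graph_def by (meson linking_mono linking_Un)
  moreover have "(image (label (K @ [a]) (L @ [b]))) ` ((image swap_side) ` f) = M"
    unfolding f(3) by (rule image_image_cong[OF f(2)]) (auto simp: variables_def nth_append len)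
  moreover have "(image (label (K @ [a]) (L @ [b]))) ` ((image ?h) ` ?one) = {{a, b}}"
  proof -
    have "?one = {{Dom 0, Cod 0}}"
      by (auto simp: id_graph_def vars_simps)
    then show ?thesis by (simp flip: len)
  qed
  ultimately have "linking (variables (hom_shape S one_shape) (hom_shape T one_shape)) ?f"
    "insert {a, b} M = (image (label (K @ [a]) (L @ [b]))) ` ?f"
    by (simp_all add: hom_graph_def image_Un)
  then show ?thesis
    unfolding derivable_def using allowable_hom[OF f(1) allowable_id[of one_shape]] len
    by (intro conjI exI[of _ ?f]) (simp_all add: vars_simps)
qed

text \<open>
  Evaluation of \<open>[S, 1]\<close> at a morphism \<open>T \<rightarrow> S\<close>, obtained by uncurrying \<open>[S, 1] \<rightarrow> [T, 1]\<close>. For \<open>S\<close> a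
  tensor power of \<open>1\<close> this is the rule that grafts subtrees onto a node.
\<close>
lemma derivable_node:
  assumes "derivable T L S K M"
  shows "derivable (tensor (hom_shape S one_shape) T) ((K @ [a]) @ L) one_shape [b]
    (insert {a, b} M)"
proof (rule derivable_uncurry)
  show "derivable (hom_shape S one_shape) (K @ [a]) (hom_shape T one_shape) (L @ [b])
      (insert {a, b} M)"
    using assms by (rule derivable_hom_one)
  show "length L = nv T" using assms by (simp add: derivable_def)
qed

text \<open>Here the domain is a list of factors, each with the names of its own variables.\<close>
abbreviation derivable_from :: "(factor \<times> 'n list) list \<Rightarrow> shape \<Rightarrow> 'n list \<Rightarrow> 'n set set \<Rightarrow> bool" where
  "derivable_from \<Gamma> \<equiv> derivable (map fst \<Gamma>) (concat (map snd \<Gamma>))"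

text \<open>
  Moving one factor to the front at a time yields every order: the factors are taken in the
  reverse of the wanted order.
\<close>
lemma derivable_from_permute:
  assumes "derivable_from \<Gamma> S K M" "mset \<Gamma>' = mset \<Gamma>"
    and names: "\<And>F L. (F, L) \<in> set \<Gamma> \<Longrightarrow> length L = nv [F]"
  shows "derivable_from \<Gamma>' S K M"
proof -
  have nv: "length (concat (map snd \<Delta>)) = nv (map fst \<Delta>)" if "set \<Delta> \<subseteq> set \<Gamma>" for \<Delta>
    using that
  proof (induction \<Delta>)
    case (Cons b \<Delta>)
    then show ?case using names[of "fst b" "snd b"] vars_simps(3)[of "[fst b]" "map fst \<Delta>"]
      by simp
  qed (simp add: vars_simps)
  have "derivable_from (rev zs @ \<Delta>) S K M"
    if "derivable_from (\<Delta> @ \<Theta>) S K M" "mset zs = mset \<Theta>" "set \<Delta> \<union> set \<Theta> \<subseteq> set \<Gamma>" for zs \<Delta> \<Theta>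
    using that
  proof (induction zs arbitrary: \<Delta> \<Theta>)
    case (Cons b zs)
    then have "b \<in> set \<Theta>" by (metis list.set_intros(1) set_mset_mset)
    then obtain \<Theta>1 \<Theta>2 where \<Theta>: "\<Theta> = \<Theta>1 @ b # \<Theta>2" by (meson split_list)
    let ?P = "\<Delta> @ \<Theta>1"
    have "derivable (tensor (tensor (map fst ?P) [fst b]) (map fst \<Theta>2))
      (concat (map snd ?P) @ snd b @ concat (map snd \<Theta>2)) S K M"
      using Cons.prems(1) by (simp add: \<Theta>)
    then have "derivable (tensor (tensor [fst b] (map fst ?P)) (map fst \<Theta>2))
      (snd b @ concat (map snd ?P) @ concat (map snd \<Theta>2)) S K M"
    proof (rule derivable_swap)
      show "length (concat (map snd ?P)) = nv (map fst ?P)"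
        using Cons.prems(3) by (intro nv) (auto simp: \<Theta>)
      show "length (snd b) = nv [fst b]"
        using Cons.prems(3) names[of "fst b" "snd b"] by (auto simp: \<Theta>)
    qed
    then have "derivable_from ((b # \<Delta>) @ (\<Theta>1 @ \<Theta>2)) S K M" by simp
    moreover have "mset zs = mset (\<Theta>1 @ \<Theta>2)" using Cons.prems(2) by (simp add: \<Theta>)
    ultimately have "derivable_from (rev zs @ (b # \<Delta>)) S K M"
      using Cons.prems(3) by (intro Cons.IH[of "b # \<Delta>" "\<Theta>1 @ \<Theta>2"]) (auto simp: \<Theta>)
    then show ?case by simp
  qed simp
  from this[of "[]" \<Gamma> "rev \<Gamma>'"] show ?thesis
    using assms(1,2) by simp
qed

section \<open>The edges of a planar tree\<close>

primrec edges :: "planar_tree \<Rightarrow> nat list set" where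
  "edges Null_Tree = {[]}"
| "edges (Node ts) = insert [] (\<Union>i<length ts. (#) i ` (map edges ts ! i))"

lemma edges_Node: "edges (Node ts) = insert [] (\<Union>i<length ts. (#) i ` edges (ts ! i))"
  by simp

lemma nodes_Node: "nodes (Node ts) = insert [] (\<Union>i<length ts. (#) i ` nodes (ts ! i))"
  by simp

lemma leaves_Node:
  "leaves (Node ts) = concat (map (\<lambda>i. map ((#) i) (leaves (ts ! i))) [0..<length ts])"
  by (auto simp: intro!: arg_cong[of _ _ concat] nth_equalityI)

declare edges.simps(2) [simp del] nodes.simps(2) [simp del] leaves.simps(2) [simp del]

lemma Nil_in_edges: "[] \<in> edges t"
  by (cases t) (auto simp: edges_Node)

lemma Nil_in_nodes_iff: "[] \<in> nodes t \<longleftrightarrow> t \<noteq> Null_Tree"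
  by (cases t) (auto simp: nodes_Node)

lemma Cons_in_nodes_iff: "i # e \<in> nodes (Node ts) \<longleftrightarrow> i < length ts \<and> e \<in> nodes (ts ! i)"
  by (auto simp: nodes_Node)

lemma Cons_in_edges_iff: "i # e \<in> edges (Node ts) \<longleftrightarrow> i < length ts \<and> e \<in> edges (ts ! i)"
  by (auto simp: edges_Node)

lemma edges_eq: "edges t = nodes t \<union> set (leaves t)"
proof (induction t)
  case (Node ts)
  then have "edges (ts ! i) = nodes (ts ! i) \<union> set (leaves (ts ! i))" if "i < length ts" for i
    using that by simp
  then show ?case
    by (auto simp: edges_Node nodes_Node leaves_Node)
qed simp

lemma nodes_leaves_disjoint: "nodes t \<inter> set (leaves t) = {}"
proof (induction t)
  case (Node ts)
  then have "nodes (ts ! i) \<inter> set (leaves (ts ! i)) = {}" if "i < length ts" for i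
    using that by simp
  then show ?case
    by (auto simp: nodes_Node leaves_Node)
qed simp

lemma distinct_concat_upt:
  assumes "\<And>i. i < n \<Longrightarrow> distinct (F i)"
    and "\<And>i j. i < j \<Longrightarrow> j < n \<Longrightarrow> set (F i) \<inter> set (F j) = {}"
  shows "distinct (concat (map F [0..<n]))"
  using assms
proof (induction n)
  case (Suc n)
  have "\<forall>i<n. set (F i) \<inter> set (F n) = {}"
    using Suc.prems(2) by simp
  then have "set (concat (map F [0..<n])) \<inter> set (F n) = {}"
    by auto
  then show ?case
    using Suc by simp
qed simp

lemma distinct_leaves: "distinct (leaves t)"
proof (induction t)
  case (Node ts)
  show ?case
    unfolding leaves_Node by (rule distinct_concat_upt) (use Node in \<open>auto simp: distinct_map\<close>)
qed simp

lemma child_in_edges_iff: "p @ [j] \<in> edges t \<longleftrightarrow> p \<in> nodes t \<and> j < arity t p"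
proof (induction t arbitrary: p)
  case (Node ts)
  show ?case
  proof (cases p)
    case Nil
    then show ?thesis
      using Cons_in_edges_iff[of j "[]" ts] by (auto simp: Nil_in_edges Nil_in_nodes_iff)
  next
    case (Cons i p')
    then show ?thesis
      using Node by (auto simp: Cons_in_edges_iff Cons_in_nodes_iff)
  qed
qed simp

text \<open>
  Trees are drawn with the root on top. An edge joins the variable below it, an output or a leaf, to
  an input \<open>inp p j\<close> of a node, or to \<open>x\<close> if it is the root.
\<close>
definition upper :: "'n \<Rightarrow> (nat list \<Rightarrow> nat \<Rightarrow> 'n) \<Rightarrow> nat list \<Rightarrow> 'n" where
  "upper x inp e = (if e = [] then x else inp (butlast e) (last e))"

text \<open>
  The four kinds of pairs in the morphism of a tree are one pair for each edge: the lower end is an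
  output or a leaf, the upper end an input or the root.
\<close>
lemma tree_graph_eq_edges:
  assumes T: "combed_tree T \<rho> \<tau>"
    and low_node: "\<And>p. p \<in> nodes T \<Longrightarrow> low p = var_out (node_arities T \<tau>) (\<tau> p)"
    and low_leaf: "\<And>q. q < length (leaves T) \<Longrightarrow> low (leaves T ! q) = Cod (\<rho> q)"
    and inp: "\<And>p j. p \<in> nodes T \<Longrightarrow> j < arity T p \<Longrightarrow> inp p j = var_in (node_arities T \<tau>) (\<tau> p) j"
  shows "tree_graph T \<rho> \<tau> = (\<lambda>e. {low e, upper (Cod (length (leaves T))) inp e}) ` edges T"
    (is "_ = ?L ` _")
proof -
  define k l ms N where "k = card (nodes T)" and "l = length (leaves T)"
    and "ms = node_arities T \<tau>" and "N = node_at T \<tau>"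
  have bij: "bij_betw \<tau> (nodes T) {..<k}" and \<rho>: "\<rho> permutes {..<l}"
    using T by (auto simp: combed_tree_def k_def l_def)
  have N: "N i \<in> nodes T" "\<tau> (N i) = i" if "i < k" for i
    using that bij unfolding N_def node_at_def
    by (auto simp: bij_betw_def intro!: inv_into_into f_inv_into_f)
  have N_\<tau>: "N (\<tau> p) = p" "\<tau> p < k" if "p \<in> nodes T" for p
    using that bij unfolding N_def node_at_def by (auto simp: bij_betw_def)
  have ms: "ms ! i = arity T (N i)" if "i < k" for i
    using that by (simp add: ms_def node_arities_def k_def N_def)
  have up: "upper (Cod l) inp (p @ [j]) = var_in ms (\<tau> p) j" if "p @ [j] \<in> edges T" for p j
    using that inp by (auto simp: upper_def child_in_edges_iff ms_def)
  have up0: "upper (Cod l) inp [] = Cod l"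
    by (simp add: upper_def)
  have tree: "tree_graph T \<rho> \<tau> =
      {{var_in ms i j, var_out ms r} | i j r.
         i < k \<and> j < ms ! i \<and> r < k \<and> N i @ [j] = N r} \<union>
      {{var_in ms i j, Cod (\<rho> q)} | i j q.
         i < k \<and> j < ms ! i \<and> q < l \<and> N i @ [j] = leaves T ! q} \<union>
      {{var_out ms r, Cod l} | r. r < k \<and> N r = []} \<union>
      (if T = Null_Tree then {{Cod 0, Cod l}} else {})" (is "_ = ?A \<union> ?B \<union> ?C \<union> ?D")
    unfolding tree_graph_def Let_def k_def l_def ms_def N_def by (rule refl)
  have edge: "N i @ [j] \<in> edges T" if "i < k" "j < ms ! i" for i j
    using that N ms by (simp add: child_in_edges_iff)
  show ?thesis
  proof
    show "tree_graph T \<rho> \<tau> \<subseteq> ?L ` edges T"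
    proof
      fix x assume "x \<in> tree_graph T \<rho> \<tau>"
      then consider "x \<in> ?A" | "x \<in> ?B" | "x \<in> ?C" | "x \<in> ?D"
        unfolding tree by blast
      then show "x \<in> ?L ` edges T"
      proof cases
        case 1
        then obtain i j r where x: "x = {var_in ms i j, var_out ms r}"
          and ij: "i < k" "j < ms ! i" "r < k" "N i @ [j] = N r" by blast
        have "x = ?L (N i @ [j])"
          using up[OF edge[OF ij(1,2)]] low_node[of "N r"] N ij
          by (simp add: x insert_commute l_def ms_def)
        then show ?thesis using edge[OF ij(1,2)] by blast
      next
        case 2
        then obtain i j q where x: "x = {var_in ms i j, Cod (\<rho> q)}"
          and ij: "i < k" "j < ms ! i" "q < l" "N i @ [j] = leaves T ! q" by blast
        have "x = ?L (N i @ [j])"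
          using up[OF edge[OF ij(1,2)]] low_leaf[of q] N ij
          by (simp add: x insert_commute l_def ms_def)
        then show ?thesis using edge[OF ij(1,2)] by blast
      next
        case 3
        then obtain r where x: "x = {var_out ms r, Cod l}" and r: "r < k" "N r = []" by blast
        have "x = ?L []"
          using low_node[of "[]"] N[of r] r up0 by (simp add: x l_def ms_def)
        then show ?thesis using Nil_in_edges by blast
      next
        case 4
        then have T: "T = Null_Tree" and x: "x = {Cod 0, Cod l}" by (auto split: if_splits)
        have "\<rho> 0 = 0"
          using \<rho> permutes_in_image[OF \<rho>, of 0] by (simp add: l_def T)
        then have "x = ?L []"
          using low_leaf[of 0] up0 by (simp add: x T l_def)
        then show ?thesis using Nil_in_edges by blast
      qed
    qed
    show "?L ` edges T \<subseteq> tree_graph T \<rho> \<tau>"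
    proof (rule image_subsetI)
      fix e assume e: "e \<in> edges T"
      have low: "(\<exists>r<k. N r = e \<and> low e = var_out ms r) \<or>
          (\<exists>q<l. leaves T ! q = e \<and> low e = Cod (\<rho> q))"
      proof (cases "e \<in> nodes T")
        case True
        then show ?thesis using N_\<tau>[OF True] low_node[OF True] by (auto simp: ms_def)
      next
        case False
        then obtain q where "q < l" "leaves T ! q = e"
          using e by (auto simp: edges_eq in_set_conv_nth l_def)
        then show ?thesis using low_leaf[of q] by (auto simp: l_def)
      qed
      show "?L e \<in> tree_graph T \<rho> \<tau>"
      proof (cases e rule: rev_cases)
        case Nil
        show ?thesis
        proof (cases "T = Null_Tree")
          case True
          have "\<rho> 0 = 0"
            using \<rho> permutes_in_image[OF \<rho>, of 0] by (simp add: l_def True)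
          then have "?L e = {Cod 0, Cod l}"
            using low_leaf[of 0] up0 by (simp add: Nil True l_def)
          then show ?thesis unfolding tree using True by simp
        next
          case False
          then have "e \<in> nodes T" by (simp add: Nil Nil_in_nodes_iff)
          from N_\<tau>[OF this] low_node[OF this] have "?L e \<in> ?C"
            using up0 Nil by (auto simp: l_def ms_def)
          then show ?thesis unfolding tree by blast
        qed
      next
        case (snoc p j)
        then have p: "p \<in> nodes T" "j < arity T p"
          using e by (auto simp: child_in_edges_iff)
        let ?i = "\<tau> p"
        have i: "?i < k" "j < ms ! ?i" "N ?i @ [j] = e"
          using N_\<tau>[OF p(1)] p(2) ms snoc by auto
        have L: "?L e = {var_in ms ?i j, low e}"
          using up[of p j] e by (auto simp: snoc l_def)
        from low consider r where "r < k" "N r = e" "low e = var_out ms r"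
          | q where "q < l" "leaves T ! q = e" "low e = Cod (\<rho> q)" by blast
        then show ?thesis
        proof cases
          case 1
          then have "?L e \<in> ?A"
            unfolding L by (intro CollectI exI[of _ ?i] exI[of _ j] exI[of _ r]) (simp add: i)
          then show ?thesis unfolding tree by blast
        next
          case 2
          then have "?L e \<in> ?B"
            unfolding L by (intro CollectI exI[of _ ?i] exI[of _ j] exI[of _ q]) (simp add: i)
          then show ?thesis unfolding tree by blast
        qed
      qed
    qed
  qed
qed

section \<open>The morphism of a tree is allowable\<close>

text \<open>The factor, with the names of its variables, that is contributed by an edge: its node or leaf.\<close>
definition block ::
  "planar_tree \<Rightarrow> (nat list \<Rightarrow> 'n) \<Rightarrow> (nat list \<Rightarrow> nat \<Rightarrow> 'n) \<Rightarrow> nat list \<Rightarrow> factor \<times> 'n list" where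
  "block t low inp e =
     (if e \<in> nodes t
      then (Hom (replicate (arity t e) One) one_shape, map (inp e) [0..<arity t e] @ [low e])
      else (One, [low e]))"

lemma block_names: "length (snd (block t low inp e)) = nv [fst (block t low inp e)]"
proof -
  have "nv (replicate n One) = n" for n
    by (induction n) (auto simp: vars_def)
  then show ?thesis by (auto simp: block_def vars_simps)
qed

lemma derivable_tensor_power:
  assumes "\<And>i. i < n \<Longrightarrow> derivable_from (\<Gamma> i) one_shape [x i] (M i)"
  shows "derivable_from (concat (map \<Gamma> [0..<n])) (replicate n One) (map x [0..<n]) (\<Union>i<n. M i)"
  using assms
proof (induction n)
  case 0
  show ?case
    unfolding derivable_def
    using allowable_id[of unit_shape] linking_id[of unit_shape]
    by (intro conjI exI[of _ "id_graph unit_shape"]) (simp_all add: vars_simps id_graph_def)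
next
  case (Suc n)
  have "derivable_from (concat (map \<Gamma> [0..<n]) @ \<Gamma> n) (tensor (replicate n One) one_shape)
      (map x [0..<n] @ [x n]) ((\<Union>i<n. M i) \<union> M n)"
    using derivable_tensor[OF Suc.IH Suc.prems[of n]] Suc.prems by simp
  then show ?case
    by (simp add: replicate_append_same lessThan_Suc Un_commute)
qed

text \<open>
  The order \<open>es\<close> of the factors is the one that the induction produces, each node followed by its
  subtrees.
\<close>
lemma tree_derivable:
  "\<exists>es. distinct es \<and> set es = edges t \<and>
     derivable_from (map (block t low inp) es) one_shape [x]
       ((\<lambda>e. {low e, upper x inp e}) ` edges t)"
proof (induction t arbitrary: low inp x)
  case Null_Tree
  show ?case
    by (intro exI[of _ "[[]]"]) (simp add: block_def upper_def derivable_axiom)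
next
  case (Node ts)
  let ?n = "length ts" and ?t = "Node ts"
  let ?M = "\<lambda>e. {low e, upper x inp e}"
  define good where "good i es \<longleftrightarrow> distinct es \<and> set es = edges (ts ! i) \<and>
     derivable_from (map (\<lambda>e. block ?t low inp (i # e)) es) one_shape [inp [] i]
       ((\<lambda>e. ?M (i # e)) ` edges (ts ! i))" for i es
  have "\<exists>es. good i es" if "i < ?n" for i
  proof -
    have "block (ts ! i) (\<lambda>e. low (i # e)) (\<lambda>e. inp (i # e)) e = block ?t low inp (i # e)" for e
      using that by (simp add: block_def Cons_in_nodes_iff)
    moreover have "upper (inp [] i) (\<lambda>e. inp (i # e)) e = upper x inp (i # e)" for e
      by (simp add: upper_def)
    ultimately show ?thesis
      using Node[of "ts ! i" "\<lambda>e. low (i # e)" "\<lambda>e. inp (i # e)" "inp [] i"] that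
      by (simp add: good_def)
  qed
  then obtain es where "\<And>i. i < ?n \<Longrightarrow> good i (es i)"
    by metis
  then have es: "distinct (es i)" "set (es i) = edges (ts ! i)"
     "derivable_from (map (\<lambda>e. block ?t low inp (i # e)) (es i)) one_shape [inp [] i]
       ((\<lambda>e. ?M (i # e)) ` edges (ts ! i))" if "i < ?n" for i
    using that by (simp_all add: good_def)
  define es' where "es' = concat (map (\<lambda>i. map ((#) i) (es i)) [0..<?n])"
  have "derivable_from (concat (map (\<lambda>i. map (\<lambda>e. block ?t low inp (i # e)) (es i)) [0..<?n]))
     (replicate ?n One) (map (inp []) [0..<?n]) (\<Union>i<?n. (\<lambda>e. ?M (i # e)) ` edges (ts ! i))"
    using es(3) by (rule derivable_tensor_power)
  moreover have "concat (map (\<lambda>i. map (\<lambda>e. block ?t low inp (i # e)) (es i)) [0..<?n]) =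
      map (block ?t low inp) es'"
    by (simp add: es'_def map_concat comp_def)
  ultimately have "derivable_from (map (block ?t low inp) es')
     (replicate ?n One) (map (inp []) [0..<?n]) (\<Union>i<?n. (\<lambda>e. ?M (i # e)) ` edges (ts ! i))"
    by (simp only:)
  from derivable_node[OF this, of "low []" x]
  have "derivable_from (map (block ?t low inp) ([] # es')) one_shape [x] (?M ` edges ?t)"
    by (simp add: block_def Nil_in_nodes_iff edges_Node upper_def image_UN image_image)
  moreover have "distinct ([] # es')"
  proof -
    have "distinct es'"
      unfolding es'_def by (rule distinct_concat_upt) (use es in \<open>auto simp: distinct_map\<close>)
    then show ?thesis by (auto simp: es'_def)
  qed
  moreover have "set ([] # es') = edges ?t"
    using es by (auto simp: es'_def edges_Node)
  ultimately show ?case by (intro exI[of _ "[] # es'"] conjI)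
qed

lemma tensor_list_eq_concat: "tensor_list Ts = concat Ts"
  unfolding tensor_list_def by (induction Ts) auto

lemma X_eq: "X m = [Hom (replicate m One) one_shape]"
  unfolding X_def tensor_list_eq_concat by (induction m) auto

lemma concat_block_vars:
  "concat (map (\<lambda>i. map (var_in ms i) [0..<ms ! i] @ [var_out ms i]) [0..<n])
     = map Dom [0..<\<Sum>r<n. ms ! r + 1]"
proof (induction n)
  case (Suc n)
  let ?s = "\<Sum>r<n. ms ! r + 1"
  have "map (var_in ms n) [0..<ms ! n] @ [var_out ms n] = map (\<lambda>j. Dom (?s + j)) [0..<ms ! n + 1]"
    by (simp add: var_in_def var_out_def)
  also have "\<dots> = map Dom [?s..<?s + (ms ! n + 1)]"
    by (rule nth_equalityI) (simp_all del: upt_Suc)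
  finally show ?case
    using Suc upt_add_eq_append[of 0 ?s "ms ! n + 1"] by simp
qed simp

text \<open>
  The variables of the domain and the codomain serve as their own names. Once the factors are sorted, nodes by \<open>\<tau>\<close>
  and leaves by \<open>\<rho>\<close>, and the leaves are curried, the naming is the identity, so that the pairing of
  names is the graph itself.
\<close>
lemma tree_allowable:
  assumes T: "combed_tree T \<rho> \<tau>"
  shows "allowable (tensor_list (map X (node_arities T \<tau>))) (X (length (leaves T)))
    (tree_graph T \<rho> \<tau>)"
proof -
  define k l ms N where "k = card (nodes T)" and "l = length (leaves T)"
    and "ms = node_arities T \<tau>" and "N = node_at T \<tau>"
  define P where "P = tensor_list (map X ms)"
  have bij: "bij_betw \<tau> (nodes T) {..<k}" and \<rho>: "\<rho> permutes {..<l}"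
    using T by (auto simp: combed_tree_def k_def l_def)
  have N: "N i \<in> nodes T" "\<tau> (N i) = i" if "i < k" for i
    using that bij unfolding N_def node_at_def
    by (auto simp: bij_betw_def intro!: inv_into_into f_inv_into_f)
  have bij_N: "bij_betw N {..<k} (nodes T)"
    using bij_betw_inv_into[OF bij] by (simp add: N_def node_at_def[abs_def])
  have ms: "ms ! i = arity T (N i)" if "i < k" for i
    using that by (simp add: ms_def node_arities_def k_def N_def)
  have len: "length ms = k" by (simp add: ms_def node_arities_def k_def)
  \<comment> \<open>The \<open>p\<close>-th leaf of the combed tree, which stands in planar position \<open>\<rho>\<^sup>-\<^sup>1 p\<close>.\<close>
  define leaf where "leaf p = leaves T ! (inv \<rho> p)" for p
  have bij_leaf: "bij_betw leaf {..<l} (set (leaves T))"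
  proof -
    have "bij_betw (\<lambda>q. leaves T ! q) {..<l} (set (leaves T))"
      using distinct_leaves[of T] by (simp add: l_def bij_betw_nth)
    from bij_betw_trans[OF permutes_imp_bij[OF permutes_inv[OF \<rho>]] this] show ?thesis
      by (simp add: leaf_def[abs_def] comp_def)
  qed
  define low where "low e = (if e \<in> nodes T then var_out ms (\<tau> e)
    else Cod (inv_into {..<l} leaf e))" for e
  define inp where "inp p j = var_in ms (\<tau> p) j" for p j
  have low_leaf: "low (leaf p) = Cod p" if "p < l" for p
  proof -
    have "leaf p \<in> set (leaves T)"
      using that bij_leaf by (auto simp: bij_betw_def)
    then have "leaf p \<notin> nodes T"
      using nodes_leaves_disjoint by blast
    then show ?thesis
      using bij_leaf that by (auto simp: low_def bij_betw_def)
  qed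
  have graph: "tree_graph T \<rho> \<tau> = (\<lambda>e. {low e, upper (Cod l) inp e}) ` edges T"
    unfolding l_def
  proof (rule tree_graph_eq_edges[OF T])
    fix q assume "q < length (leaves T)"
    then have "\<rho> q < l" "leaf (\<rho> q) = leaves T ! q"
      using permutes_in_image[OF \<rho>, of q] permutes_inverses(2)[OF \<rho>] by (auto simp: leaf_def l_def)
    then show "low (leaves T ! q) = Cod (\<rho> q)"
      using low_leaf[of "\<rho> q"] by simp
  qed (simp_all add: low_def inp_def ms_def)
  obtain es where es: "distinct es" "set es = edges T"
    and D: "derivable_from (map (block T low inp) es) one_shape [Cod l] (tree_graph T \<rho> \<tau>)"
    using tree_derivable[of T low inp "Cod l"] unfolding graph[symmetric] by (elim exE conjE)
  define es' where "es' = map N [0..<k] @ map leaf [0..<l]"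
  have "set es' = edges T"
    using bij_N bij_leaf by (auto simp: es'_def edges_eq bij_betw_def atLeast0LessThan)
  moreover have "distinct es'"
    using bij_N bij_leaf nodes_leaves_disjoint[of T]
    by (auto simp: es'_def distinct_map bij_betw_def atLeast0LessThan)
  ultimately have "mset es' = mset es"
    using es set_eq_iff_mset_eq_distinct by blast
  then have D': "derivable_from (map (block T low inp) es') one_shape [Cod l] (tree_graph T \<rho> \<tau>)"
  proof (intro derivable_from_permute[OF D])
    fix F L assume "(F, L) \<in> set (map (block T low inp) es)"
    then obtain e where "(F, L) = block T low inp e" by auto
    then show "length L = nv [F]" using block_names[of T low inp e] by (simp flip: \<open>(F, L) = _\<close>)
  qed simp
  have node_block: "block T low inp (N i) =
      (Hom (replicate (ms ! i) One) one_shape, map (var_in ms i) [0..<ms ! i] @ [var_out ms i])"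
    if "i < k" for i
    using that N ms by (simp add: block_def low_def inp_def)
  have leaf_block: "block T low inp (leaf p) = (One, [Cod p])" if "p < l" for p
  proof -
    have "leaf p \<in> set (leaves T)"
      using that bij_leaf by (auto simp: bij_betw_def)
    then have "leaf p \<notin> nodes T"
      using nodes_leaves_disjoint by blast
    then show ?thesis using low_leaf[OF that] by (simp add: block_def)
  qed
  have "map fst (map (block T low inp) es') =
      map (\<lambda>i. Hom (replicate (ms ! i) One) one_shape) [0..<k] @ map (\<lambda>p. One) [0..<l]"
    unfolding es'_def using node_block leaf_block by simp
  also have "map (\<lambda>i. Hom (replicate (ms ! i) One) one_shape) [0..<k] = P"
    unfolding P_def tensor_list_eq_concat X_eq[abs_def] concat_map_singleton len[symmetric]
    by (rule nth_equalityI) simp_all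
  also have "map (\<lambda>p. One) [0..<l] = replicate l One"
    by (simp add: map_replicate_const)
  finally have shapes: "map fst (map (block T low inp) es') = tensor P (replicate l One)" .
  have "map snd (map (block T low inp) es') =
      map (\<lambda>i. map (var_in ms i) [0..<ms ! i] @ [var_out ms i]) [0..<k]
      @ map (\<lambda>p. [Cod p]) [0..<l]"
    unfolding es'_def using node_block leaf_block by simp
  then have names: "concat (map snd (map (block T low inp) es')) =
      map Dom [0..<\<Sum>r<k. ms ! r + 1] @ map Cod [0..<l]"
    by (simp add: concat_block_vars del: map_map)
  have nv: "nv (replicate l One) = l"
    by (induction l) (auto simp: vars_def)
  have s: "nv P = (\<Sum>r<k. ms ! r + 1)"
    using D' unfolding shapes names by (simp add: derivable_def vars_simps nv)
  have "derivable P (map Dom [0..<nv P]) (X l) (map Cod [0..<l] @ [Cod l]) (tree_graph T \<rho> \<tau>)"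
    unfolding X_eq
    by (rule derivable_curry) (use D' in \<open>simp_all add: shapes names s del: map_map\<close>)
  then obtain f where f: "allowable P (X l) f" "linking (variables P (X l)) f"
    "tree_graph T \<rho> \<tau> = (image (label (map Dom [0..<nv P]) (map Cod [0..<l] @ [Cod l]))) ` f"
    by (auto simp: derivable_def)
  have "(image (label (map Dom [0..<nv P]) (map Cod [0..<l] @ [Cod l]))) ` ((image id) ` f)
      = (image id) ` f"
    by (rule image_image_cong[OF f(2)])
      (auto simp: variables_def X_eq vars_simps nv nth_append less_Suc_eq)
  then show ?thesis
    using f by (simp add: P_def ms_def l_def)
qed

section \<open>Variables and values of tensor products of the shapes X\<close>

definition offset :: "nat list \<Rightarrow> nat \<Rightarrow> nat" where
  "offset ms i = (\<Sum>r<i. ms ! r + 1)"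

lemma var_in_eq: "var_in ms i j = Dom (offset ms i + j)"
  by (simp add: var_in_def offset_def)

lemma var_out_eq: "var_out ms i = Dom (offset ms i + ms ! i)"
  by (simp add: var_out_def offset_def)

lemma offset_Suc: "offset ms (Suc i) = offset ms i + ms ! i + 1"
  by (simp add: offset_def)

lemma offset_mono: "i < i' \<Longrightarrow> offset ms i + ms ! i < offset ms i'"
  by (induction i') (auto simp: offset_Suc less_Suc_eq)

lemma offset_add_inj:
  assumes "offset ms i + j = offset ms i' + j'" "j \<le> ms ! i" "j' \<le> ms ! i'"
  shows "i = i' \<and> j = j'"
proof (cases i i' rule: linorder_cases)
  case less
  then show ?thesis using assms offset_mono[of i i' ms] by linarith
next
  case greater
  then show ?thesis using assms offset_mono[of i' i ms] by linarith
qed (use assms in auto)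

lemma offset_decode:
  assumes "n < offset ms k"
  obtains i j where "i < k" "j \<le> ms ! i" "n = offset ms i + j"
  using assms
proof (induction k arbitrary: thesis)
  case (Suc k)
  show ?case
  proof (cases "n < offset ms k")
    case True
    then show ?thesis using Suc by (metis less_SucI)
  next
    case False
    then show ?thesis
      using Suc.prems(1)[of k "n - offset ms k"] Suc.prems(2) by (auto simp: offset_Suc)
  qed
qed (simp add: offset_def)

lemma offset_append: "i \<le> length ms \<Longrightarrow> offset (ms @ ms') i = offset ms i"
  by (auto simp: offset_def nth_append intro!: sum.cong)

lemma vars_X: "vars (X m) = replicate m Minus @ [Plus]"
proof -
  have "vars (replicate m One) = replicate m Plus"
    by (induction m) (auto simp: vars_def)
  then show ?thesis by (simp add: X_eq vars_simps)
qed

lemma vars_tensor_X: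
  "nv (tensor_list (map X ms)) = offset ms (length ms) \<and>
   (\<forall>i<length ms. \<forall>j\<le>ms ! i. vars (tensor_list (map X ms)) ! (offset ms i + j) =
      (if j < ms ! i then Minus else Plus))"
proof (induction ms rule: rev_induct)
  case Nil
  show ?case by (simp add: tensor_list_eq_concat vars_simps offset_def)
next
  case (snoc m ms)
  let ?P = "tensor_list (map X ms)"
  have P: "vars (tensor_list (map X (ms @ [m]))) = vars ?P @ replicate m Minus @ [Plus]"
    by (simp add: tensor_list_eq_concat vars_simps vars_X)
  have nv: "nv ?P = offset ms (length ms)" using snoc.IH by blast
  have "vars (tensor_list (map X (ms @ [m]))) ! (offset (ms @ [m]) i + j) =
      (if j < (ms @ [m]) ! i then Minus else Plus)"
    if "i < length (ms @ [m])" "j \<le> (ms @ [m]) ! i" for i j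
  proof (cases "i < length ms")
    case True
    then have "offset ms i + j < nv ?P"
      using offset_mono[OF True, of ms] that by (simp add: nv nth_append)
    then show ?thesis
      unfolding P using True that snoc.IH by (simp add: nth_append offset_append)
  next
    case False
    then have "i = length ms" using that by simp
    then show ?thesis
      unfolding P using that nv by (auto simp: nth_append offset_append)
  qed
  moreover have "nv (tensor_list (map X (ms @ [m]))) = offset (ms @ [m]) (length (ms @ [m]))"
    unfolding P by (simp add: nv offset_append offset_Suc)
  ultimately show ?case by blast
qed

lemma shape_coherence_ones:
  assumes "\<And>j. j < n \<Longrightarrow> w j = Incoherent \<or> w j = Equal"
  shows "shape_coherence (replicate n One) w =
    (if \<exists>j<n. w j = Incoherent then Incoherent else Equal)"
  using assms
proof (induction n arbitrary: w)
  case (Suc n)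
  have "shape_coherence (replicate n One) (\<lambda>i. w (Suc i)) =
      (if \<exists>j<n. w (Suc j) = Incoherent then Incoherent else Equal)"
    using Suc.prems by (intro Suc.IH) auto
  moreover have "w 0 = Incoherent \<or> w 0 = Equal"
    using Suc.prems by blast
  ultimately show ?case
    by (auto simp: Ex_less_Suc2)
qed simp

text \<open>
  A single incoherent input makes the tensor product of the inputs incoherent, hence the node
  coherent whatever its output is. This is why the test valuation below can use incoherent outputs.
\<close>
lemma shape_coherence_X:
  assumes "\<And>j. j \<le> m \<Longrightarrow> w j = Incoherent \<or> w j = Equal"
  shows "shape_coherence (X m) w = (if \<exists>j<m. w j = Incoherent then Coherent else w m)"
proof -
  have "nv (replicate m One) = m"
    by (induction m) (auto simp: vars_def)
  then have "shape_coherence (X m) w = impl (shape_coherence (replicate m One) w) (w m)"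
    unfolding X_eq shape_coherence_hom by (simp add: fuse_Equal)
  then show ?thesis
    using assms[of m] shape_coherence_ones[of m w] assms by (auto simp: impl_def dual_dual)
qed

lemma shape_coherence_tensor_X:
  assumes "\<And>i. i < length ms \<Longrightarrow> shape_coherence (X (ms ! i)) (\<lambda>j. w (offset ms i + j)) \<noteq> Incoherent"
  shows "shape_coherence (tensor_list (map X ms)) w \<noteq> Incoherent \<and>
    ((\<exists>i<length ms. shape_coherence (X (ms ! i)) (\<lambda>j. w (offset ms i + j)) = Coherent) \<longrightarrow>
     shape_coherence (tensor_list (map X ms)) w = Coherent)"
  using assms
proof (induction ms rule: rev_induct)
  case Nil
  show ?case by (simp add: tensor_list_eq_concat)
next
  case (snoc m ms)
  let ?c = "\<lambda>ms i. shape_coherence (X (ms ! i)) (\<lambda>j. w (offset ms i + j))"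
  have c: "?c (ms @ [m]) i = ?c ms i" if "i < length ms" for i
    using that by (simp add: nth_append offset_append)
  have last: "?c (ms @ [m]) (length ms) = shape_coherence (X m) (\<lambda>j. w (offset ms (length ms) + j))"
    by (simp add: offset_append)
  have eq: "shape_coherence (tensor_list (map X (ms @ [m]))) w =
      fuse (shape_coherence (tensor_list (map X ms)) w) (?c (ms @ [m]) (length ms))"
    unfolding last using vars_tensor_X[of ms]
    by (simp add: tensor_list_eq_concat shape_coherence_tensor)
  have not: "?c (ms @ [m]) i \<noteq> Incoherent" if "i < Suc (length ms)" for i
    using snoc.prems that by simp
  have IH: "shape_coherence (tensor_list (map X ms)) w \<noteq> Incoherent \<and>
    ((\<exists>i<length ms. ?c ms i = Coherent) \<longrightarrow> shape_coherence (tensor_list (map X ms)) w = Coherent)"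
  proof (rule snoc.IH)
    fix i assume "i < length ms"
    then show "?c ms i \<noteq> Incoherent" using not[of i] c[of i] by simp
  qed
  have fuse: "fuse a b \<noteq> Incoherent \<and> (a = Coherent \<or> b = Coherent \<longrightarrow> fuse a b = Coherent)"
    if "a \<noteq> Incoherent" "b \<noteq> Incoherent" for a b
    using that by (cases a; cases b) auto
  show ?case
    unfolding eq
  proof (intro conjI impI)
    show "fuse (shape_coherence (tensor_list (map X ms)) w) (?c (ms @ [m]) (length ms)) \<noteq> Incoherent"
      using IH fuse[OF _ not[of "length ms"]] by blast
    assume "\<exists>i<length (ms @ [m]). ?c (ms @ [m]) i = Coherent"
    then obtain i where i: "i < length (ms @ [m])" "?c (ms @ [m]) i = Coherent" by blast
    have "(\<exists>i<length ms. ?c ms i = Coherent) \<or> ?c (ms @ [m]) (length ms) = Coherent"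
    proof (cases "i < length ms")
      case True
      then show ?thesis using i(2) unfolding c[OF True] by blast
    next
      case False
      then have "i = length ms" using i(1) by simp
      then show ?thesis using i(2) by blast
    qed
    then show "fuse (shape_coherence (tensor_list (map X ms)) w) (?c (ms @ [m]) (length ms)) = Coherent"
      using IH fuse[OF _ not[of "length ms"]] by blast
  qed
qed

section \<open>A sound graph between the shapes X is a tree\<close>

locale X_graph =
  fixes ms :: "nat list" and l :: nat and \<xi> :: graph
  assumes graph: "is_graph (tensor_list (map X ms)) (X l) \<xi>"
begin

abbreviation "k \<equiv> length ms"

text \<open>
  Receivers are the variables of positive variance and givers (below) those of negative variance, so
  that each pair of mates consists of one of either kind.
\<close>
definition receivers :: "var set" where
  "receivers = insert (Cod l) {var_in ms i j | i j. i < k \<and> j < ms ! i}"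

definition givers :: "var set" where
  "givers = {var_out ms r | r. r < k} \<union> {Cod p | p. p < l}"

lemma mate_unique: "{x, y} \<in> \<xi> \<Longrightarrow> {x, z} \<in> \<xi> \<Longrightarrow> y = z"
proof -
  assume xy: "{x, y} \<in> \<xi>" "{x, z} \<in> \<xi>"
  have "disjoint \<xi>" using graph by (simp add: is_graph_def partition_on_def)
  from disjointD[OF this xy] have "{x, y} = {x, z}" by fastforce
  then show "y = z" by (auto simp: doubleton_eq_iff)
qed

lemma variables_eq: "variables (tensor_list (map X ms)) (X l) = receivers \<union> givers"
proof
  have nv: "nv (tensor_list (map X ms)) = offset ms k" "nv (X l) = Suc l"
    using vars_tensor_X[of ms] by (simp_all add: vars_X)
  show "variables (tensor_list (map X ms)) (X l) \<subseteq> receivers \<union> givers"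
  proof
    fix x assume x: "x \<in> variables (tensor_list (map X ms)) (X l)"
    show "x \<in> receivers \<union> givers"
    proof (cases x)
      case (Dom n)
      then have "n < offset ms k" using x by (auto simp: variables_def nv)
      then obtain i j where "i < k" "j \<le> ms ! i" "n = offset ms i + j"
        by (rule offset_decode)
      then show ?thesis
        unfolding Dom receivers_def givers_def var_in_eq var_out_eq
        by (cases "j = ms ! i") (auto dest: le_neq_implies_less)
    next
      case (Cod p)
      then have "p < Suc l" using x by (auto simp: variables_def nv)
      then show ?thesis
        unfolding Cod receivers_def givers_def by (cases "p = l") auto
    qed
  qed
  have "offset ms i + j < offset ms k" if "i < k" "j \<le> ms ! i" for i j
    using offset_mono[of i k ms] that by linarith
  then show "receivers \<union> givers \<subseteq> variables (tensor_list (map X ms)) (X l)"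
    unfolding variables_def nv receivers_def givers_def var_in_eq var_out_eq by auto
qed

lemma variance_receiver: "x \<in> receivers \<Longrightarrow> variance (tensor_list (map X ms)) (X l) x = Plus"
  using vars_tensor_X[of ms] by (auto simp: receivers_def var_in_eq vars_X nth_append)

lemma variance_giver: "x \<in> givers \<Longrightarrow> variance (tensor_list (map X ms)) (X l) x = Minus"
  using vars_tensor_X[of ms] by (auto simp: givers_def var_out_eq vars_X nth_append)

lemma link_ends:
  assumes "{x, y} \<in> \<xi>"
  shows "x \<in> receivers \<union> givers" "y \<in> receivers \<union> givers"
    "x \<in> receivers \<longleftrightarrow> y \<in> givers" "x \<in> givers \<longleftrightarrow> y \<in> receivers"
proof -
  have "\<Union>\<xi> = receivers \<union> givers"
    using graph variables_eq by (simp add: is_graph_def partition_on_def)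
  then show xy: "x \<in> receivers \<union> givers" "y \<in> receivers \<union> givers"
    using assms by auto
  have "variance (tensor_list (map X ms)) (X l) x \<noteq> variance (tensor_list (map X ms)) (X l) y"
    using graph assms by (auto simp: is_graph_def)
  then show "x \<in> receivers \<longleftrightarrow> y \<in> givers" "x \<in> givers \<longleftrightarrow> y \<in> receivers"
    using xy variance_receiver[of x] variance_receiver[of y] variance_giver[of x] variance_giver[of y]
    by auto
qed

lemma mate_exists:
  assumes "x \<in> receivers \<union> givers"
  obtains y where "{x, y} \<in> \<xi>"
proof -
  have "\<Union>\<xi> = receivers \<union> givers"
    using graph variables_eq by (simp add: is_graph_def partition_on_def)
  then obtain e where e: "e \<in> \<xi>" "x \<in> e" using assms by blast
  then have "card e = 2" using graph by (auto simp: is_graph_def)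
  then obtain a b where "e = {a, b}" by (auto simp: card_2_iff)
  then show thesis using e that by (auto simp: insert_commute)
qed

lemma mate_of_receiver:
  assumes "x \<in> receivers"
  obtains y where "{x, y} \<in> \<xi>" "y \<in> givers"
  using assms mate_exists[of x] link_ends(3) by blast

lemma mate_of_giver:
  assumes "y \<in> givers"
  obtains x where "{x, y} \<in> \<xi>" "x \<in> receivers"
  using assms mate_exists[of y] link_ends(4) by (metis UnCI insert_commute)

lemma var_in_inj:
  "\<lbrakk>var_in ms i j = var_in ms i' j'; j < ms ! i; j' < ms ! i'\<rbrakk> \<Longrightarrow> i = i' \<and> j = j'"
  using offset_add_inj[of ms i j i' j'] by (simp add: var_in_eq)

lemma var_out_inj: "var_out ms r = var_out ms s \<Longrightarrow> r = s"
  using offset_add_inj[of ms r "ms ! r" s "ms ! s"] by (simp add: var_out_eq)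

definition child :: "(nat \<times> nat) set" where
  "child = {(s, r). s < k \<and> r < k \<and> (\<exists>j<ms ! r. {var_in ms r j, var_out ms s} \<in> \<xi>)}"

lemma out_in_givers: "r < k \<Longrightarrow> var_out ms r \<in> givers"
  by (auto simp: givers_def)

lemma in_in_receivers: "i < k \<Longrightarrow> j < ms ! i \<Longrightarrow> var_in ms i j \<in> receivers"
  by (auto simp: receivers_def)

lemma receivers_givers_disjoint: "x \<in> receivers \<Longrightarrow> x \<notin> givers"
  using variance_receiver[of x] variance_giver[of x] by auto

text \<open>
  The test valuation makes the outputs of the nodes in \<open>Q\<close> incoherent. A node in \<open>Q\<close> then has an
  incoherent input, hence is coherent; a node outside \<open>Q\<close> has an output of value equal, hence is
  not incoherent. In the codomain only the result can be incoherent.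
\<close>
lemma sound_no_infinite_descent:
  assumes sound: "sound (tensor_list (map X ms)) (X l) \<xi>"
    and Q: "\<And>r. r \<in> Q \<Longrightarrow> \<exists>s\<in>Q. (s, r) \<in> child"
  shows "Q = {}"
proof (rule ccontr)
  assume "Q \<noteq> {}"
  have Qk: "r < k" if "r \<in> Q" for r
    using Q[OF that] by (auto simp: child_def)
  define v where "v x = (if \<exists>s\<in>Q. x = var_out ms s \<or> {x, var_out ms s} \<in> \<xi> then Incoherent else Equal)"
    for x
  have v_cases: "v x = Incoherent \<or> v x = Equal" for x
    by (simp add: v_def)
  have v_imp: "v y = Incoherent" if xy: "{x, y} \<in> \<xi>" "v x = Incoherent" for x y
  proof -
    obtain s where s: "s \<in> Q" "x = var_out ms s \<or> {x, var_out ms s} \<in> \<xi>"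
      using xy(2) by (auto simp: v_def split: if_splits)
    then have "{y, var_out ms s} \<in> \<xi> \<or> y = var_out ms s"
      using xy(1) mate_unique[of x y "var_out ms s"] by (auto simp: insert_commute)
    then show ?thesis using s(1) by (auto simp: v_def)
  qed
  have "constant_on_mates \<xi> v"
    unfolding constant_on_mates_def
  proof (intro allI impI)
    fix x y assume "{x, y} \<in> \<xi>"
    then show "v x = v y"
      using v_imp[of x y] v_imp[of y x] v_cases[of x] v_cases[of y] by (auto simp: insert_commute)
  qed
  from soundD[OF sound this]
  have below: "below (shape_coherence (tensor_list (map X ms)) (\<lambda>i. v (Dom i)))
      (shape_coherence (X l) (\<lambda>j. v (Cod j)))" .
  have giver: "v x = Equal" if x: "x \<in> givers" "\<And>s. s \<in> Q \<Longrightarrow> x \<noteq> var_out ms s" for x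
  proof -
    have "{x, var_out ms s} \<notin> \<xi>" if "s \<in> Q" for s
      using link_ends(4)[of x "var_out ms s"] x(1) out_in_givers[OF Qk[OF that]]
        receivers_givers_disjoint by blast
    then show ?thesis using x(2) by (auto simp: v_def)
  qed
  let ?c = "\<lambda>i. shape_coherence (X (ms ! i)) (\<lambda>j. v (Dom (offset ms i + j)))"
  have c: "?c i = (if \<exists>j<ms ! i. v (var_in ms i j) = Incoherent then Coherent else v (var_out ms i))" for i
    unfolding var_in_eq var_out_eq by (rule shape_coherence_X) (rule v_cases)
  have in_Q: "?c i = Coherent" if i: "i \<in> Q" for i
  proof -
    obtain s j where "s \<in> Q" "j < ms ! i" "{var_in ms i j, var_out ms s} \<in> \<xi>"
      using Q[OF i] by (auto simp: child_def)
    then have "v (var_in ms i j) = Incoherent" by (auto simp: v_def)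
    then show ?thesis using c \<open>j < ms ! i\<close> by auto
  qed
  have not_in_Q: "?c i \<noteq> Incoherent" if "i < k" "i \<notin> Q" for i
  proof -
    have "v (var_out ms i) = Equal"
      using that by (intro giver out_in_givers) (auto dest: var_out_inj)
    then show ?thesis using c by simp
  qed
  obtain r where "r \<in> Q" using \<open>Q \<noteq> {}\<close> by blast
  then have "shape_coherence (tensor_list (map X ms)) (\<lambda>i. v (Dom i)) = Coherent"
    using shape_coherence_tensor_X[of ms "\<lambda>i. v (Dom i)"] in_Q not_in_Q Qk by (metis coherence.distinct(3))
  moreover have "shape_coherence (X l) (\<lambda>j. v (Cod j)) \<noteq> Coherent"
  proof -
    have "v (Cod p) = Equal" if "p < l" for p
      using that by (intro giver) (auto simp: givers_def var_out_eq)
    then show ?thesis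
      using shape_coherence_X[of l "\<lambda>j. v (Cod j)"] v_cases
      by (metis coherence.distinct(1,3,5))
  qed
  ultimately show False using below by simp
qed

lemma wf_child:
  assumes "sound (tensor_list (map X ms)) (X l) \<xi>"
  shows "wf child"
proof (rule wfI_min)
  fix x and Q :: "nat set" assume "x \<in> Q"
  then show "\<exists>z\<in>Q. \<forall>y. (y, z) \<in> child \<longrightarrow> y \<notin> Q"
    using sound_no_infinite_descent[OF assms, of Q] by blast
qed

text \<open>Induction from the root downwards; with it one sees that the tree below the root misses no node.\<close>
lemma wf_parent: "wf child \<Longrightarrow> wf (child\<inverse>)"
proof (rule finite_acyclic_wf_converse)
  show "finite child"
    by (rule finite_subset[of _ "{..<k} \<times> {..<k}"]) (auto simp: child_def)
qed (rule wf_acyclic)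

text \<open>
  The planar tree \<open>t\<close> is the part of \<open>\<xi>\<close> that hangs from the receiver \<open>x\<close>, drawn with its root on top:
  \<open>low e\<close> is the giver, an output or an argument of the codomain, at the lower end of the edge \<open>e\<close>.
\<close>
definition labels :: "var \<Rightarrow> planar_tree \<Rightarrow> (nat list \<Rightarrow> var) \<Rightarrow> bool" where
  "labels x t low \<longleftrightarrow> {x, low []} \<in> \<xi> \<and>
     (\<forall>p\<in>nodes t. \<exists>r<k. low p = var_out ms r \<and> arity t p = ms ! r \<and>
        (\<forall>j<ms ! r. {var_in ms r j, low (p @ [j])} \<in> \<xi>)) \<and>
     (\<forall>p\<in>set (leaves t). \<exists>q<l. low p = Cod q)"

text \<open>The subtrees at the inputs of \<open>N\<^sub>r\<close> come from the induction, as their nodes are children of \<open>r\<close>.\<close>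
lemma labels_exist_node:
  assumes "wf child" "r < k" "{x, var_out ms r} \<in> \<xi>"
  shows "\<exists>t low. labels x t low"
  using assms
proof (induction r arbitrary: x rule: wf_induct_rule)
  case (less r)
  have "\<exists>t low. labels (var_in ms r j) t low" if j: "j < ms ! r" for j
  proof -
    obtain y where y: "{var_in ms r j, y} \<in> \<xi>" "y \<in> givers"
      using mate_of_receiver[OF in_in_receivers[OF less.prems(1) j]] .
    from y(2) consider s where "s < k" "y = var_out ms s" | p where "p < l" "y = Cod p"
      by (auto simp: givers_def)
    then show ?thesis
    proof cases
      case 1
      then have "(s, r) \<in> child" using j less.prems(1) y by (auto simp: child_def)
      then show ?thesis using less.IH[of s "var_in ms r j"] 1 y by blast
    next
      case 2
      then have "labels (var_in ms r j) Null_Tree (\<lambda>_. Cod p)"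
        using y by (auto simp: labels_def)
      then show ?thesis by blast
    qed
  qed
  then obtain t low where tl: "\<And>j. j < ms ! r \<Longrightarrow> labels (var_in ms r j) (t j) (low j)"
    by metis
  define T where "T = Node (map t [0..<ms ! r])"
  define L where "L e = (case e of [] \<Rightarrow> var_out ms r | i # e' \<Rightarrow> low i e')" for e
  have L: "L [] = var_out ms r" "L (i # e) = low i e" for i e
    by (simp_all add: L_def)
  have "labels x T L"
    unfolding labels_def
  proof (intro conjI ballI)
    show "{x, L []} \<in> \<xi>" using less.prems(2) by (simp add: L)
  next
    fix p assume p: "p \<in> nodes T"
    show "\<exists>r<k. L p = var_out ms r \<and> arity T p = ms ! r \<and>
        (\<forall>j<ms ! r. {var_in ms r j, L (p @ [j])} \<in> \<xi>)"
    proof (cases p)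
      case Nil
      have "{var_in ms r j, L (p @ [j])} \<in> \<xi>" if "j < ms ! r" for j
        using tl[OF that] by (simp add: Nil L labels_def)
      then show ?thesis
        using less.prems(1) by (intro exI[of _ r]) (simp add: Nil L T_def)
    next
      case (Cons i p')
      then have "i < ms ! r" "p' \<in> nodes (t i)"
        using p by (auto simp: T_def Cons_in_nodes_iff)
      then show ?thesis
        using tl[of i] by (simp add: Cons L T_def labels_def)
    qed
  next
    fix p assume "p \<in> set (leaves T)"
    then obtain i p' where "i < ms ! r" "p' \<in> set (leaves (t i))" "p = i # p'"
      by (auto simp: T_def leaves_Node)
    then show "\<exists>q<l. L p = Cod q"
      using tl[of i] by (simp add: L labels_def)
  qed
  then show ?case by blast
qed

lemma labels_exist:
  assumes "wf child"
  obtains t low where "labels (Cod l) t low"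
proof -
  have "Cod l \<in> receivers" by (simp add: receivers_def)
  then obtain y where y: "{Cod l, y} \<in> \<xi>" "y \<in> givers"
    by (rule mate_of_receiver)
  from y(2) consider s where "s < k" "y = var_out ms s" | p where "p < l" "y = Cod p"
    by (auto simp: givers_def)
  then show thesis
  proof cases
    case 1
    then show ?thesis using labels_exist_node[OF assms] y that by blast
  next
    case 2
    then have "labels (Cod l) Null_Tree (\<lambda>_. Cod p)"
      using y by (auto simp: labels_def)
    then show ?thesis by (rule that)
  qed
qed

text \<open>
  Once \<open>low\<close> is a bijection from the edges of \<open>T\<close> to the givers, \<open>\<tau>\<close> and \<open>\<rho>\<close> are read off from it.
  It is injective because the mate of \<open>low e\<close> determines the last step of \<open>e\<close> and the node above it;
  it is surjective because every giver leads upwards to the root.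
\<close>
lemma labelled_tree:
  assumes wf: "wf child" and lab: "labels (Cod l) T low"
  shows "\<exists>\<rho> \<tau>. combed_tree T \<rho> \<tau> \<and> node_arities T \<tau> = ms \<and> length (leaves T) = l \<and>
    \<xi> = tree_graph T \<rho> \<tau>"
proof -
  obtain \<tau> where \<tau>: "\<And>p. p \<in> nodes T \<Longrightarrow> \<tau> p < k \<and> low p = var_out ms (\<tau> p) \<and> arity T p = ms ! \<tau> p
      \<and> (\<forall>j<ms ! \<tau> p. {var_in ms (\<tau> p) j, low (p @ [j])} \<in> \<xi>)"
    using lab unfolding labels_def by metis
  obtain \<sigma> where \<sigma>: "\<And>p. p \<in> set (leaves T) \<Longrightarrow> \<sigma> p < l \<and> low p = Cod (\<sigma> p)"
    using lab unfolding labels_def by metis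
  define inp where "inp p j = var_in ms (\<tau> p) j" for p j
  let ?up = "upper (Cod l) inp"
  have link: "{?up e, low e} \<in> \<xi>" if "e \<in> edges T" for e
  proof (cases e rule: rev_cases)
    case Nil
    then show ?thesis using lab by (simp add: labels_def upper_def)
  next
    case (snoc p j)
    then show ?thesis
      using that \<tau>[of p] by (simp add: upper_def inp_def child_in_edges_iff)
  qed
  have low_inj: "e = e'" if "e \<in> edges T" "e' \<in> edges T" "low e = low e'" for e e'
    using that
  proof (induction e arbitrary: e' rule: rev_induct)
    case Nil
    have "?up e' = Cod l"
      using link[OF Nil(1)] link[OF Nil(2)] Nil(3) mate_unique[of "low e'" "?up e'" "?up []"]
      by (simp add: insert_commute upper_def)
    then show ?case by (auto simp: upper_def inp_def var_in_def split: if_splits)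
  next
    case (snoc j p)
    have up: "?up e' = var_in ms (\<tau> p) j"
      using link[OF snoc.prems(1)] link[OF snoc.prems(2)] snoc.prems(3)
        mate_unique[of "low e'" "?up e'" "?up (p @ [j])"]
      by (simp add: insert_commute upper_def inp_def)
    then have "e' \<noteq> []" by (auto simp: upper_def var_in_def)
    then obtain p' j' where e': "e' = p' @ [j']" by (metis rev_exhaust)
    have p: "p \<in> nodes T" "j < arity T p" "p' \<in> nodes T" "j' < arity T p'"
      using snoc.prems(1,2) by (simp_all add: child_in_edges_iff e')
    have "var_in ms (\<tau> p') j' = var_in ms (\<tau> p) j"
      using up by (simp add: e' upper_def inp_def)
    then have "\<tau> p' = \<tau> p" "j' = j"
      using var_in_inj[of "\<tau> p'" j' "\<tau> p" j] \<tau> p by auto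
    then have "low p = low p'" using \<tau> p by simp
    then have "p = p'" using p by (intro snoc.IH) (simp_all add: edges_eq)
    then show ?case using \<open>j' = j\<close> by (simp add: e')
  qed
  \<comment> \<open>A giver is reached as soon as the node to whose input it is attached has been reached.\<close>
  have step: "\<exists>e\<in>edges T. low e = y"
    if y: "{x, y} \<in> \<xi>" "x \<in> receivers" and node: "\<And>s j. s < k \<Longrightarrow> j < ms ! s \<Longrightarrow> x = var_in ms s j \<Longrightarrow>
      \<exists>p\<in>nodes T. low p = var_out ms s" for x y
  proof (cases "x = Cod l")
    case True
    then show ?thesis
      using y link[OF Nil_in_edges] mate_unique[of "Cod l" y "low []"] Nil_in_edges
      by (auto simp: upper_def)
  next
    case False
    then obtain s j where s: "s < k" "j < ms ! s" "x = var_in ms s j"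
      using y(2) by (auto simp: receivers_def)
    from node[OF this] obtain p where p: "p \<in> nodes T" "low p = var_out ms s" by blast
    then have "\<tau> p = s" using \<tau>[OF p(1)] var_out_inj by simp
    then have e: "p @ [j] \<in> edges T" and "{var_in ms s j, low (p @ [j])} \<in> \<xi>"
      using \<tau>[OF p(1)] p s by (auto simp: child_in_edges_iff)
    then have "low (p @ [j]) = y"
      using y(1) s(3) mate_unique by blast
    then show ?thesis using e by blast
  qed
  have node_surj: "\<exists>p\<in>nodes T. low p = var_out ms r" if "r < k" for r
    using that
  proof (induction r rule: wf_induct_rule[OF wf_parent[OF wf]])
    case (1 r)
    obtain x where x: "{x, var_out ms r} \<in> \<xi>" "x \<in> receivers"
      using mate_of_giver[OF out_in_givers[OF 1(2)]] .
    then have "\<exists>e\<in>edges T. low e = var_out ms r"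
    proof (rule step)
      fix s j assume "s < k" "j < ms ! s" "x = var_in ms s j"
      then show "\<exists>p\<in>nodes T. low p = var_out ms s"
        using x 1 by (intro 1(1)) (auto simp: child_def)
    qed
    then obtain e where e: "e \<in> edges T" "low e = var_out ms r" by blast
    have "e \<in> nodes T"
      using e \<sigma>[of e] by (auto simp: edges_eq var_out_def)
    then show ?case using e by blast
  qed
  have low_surj: "\<exists>e\<in>edges T. low e = y" if "y \<in> givers" for y
  proof -
    obtain x where "{x, y} \<in> \<xi>" "x \<in> receivers"
      using mate_of_giver[OF \<open>y \<in> givers\<close>] .
    then show ?thesis by (rule step) (rule node_surj)
  qed
  have bij_\<tau>: "bij_betw \<tau> (nodes T) {..<k}"
    unfolding bij_betw_def
  proof
    show "inj_on \<tau> (nodes T)"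
      using low_inj \<tau> by (auto simp: inj_on_def edges_eq)
    show "\<tau> ` nodes T = {..<k}"
      using \<tau> node_surj var_out_inj by (force simp: image_iff)
  qed
  then have card: "card (nodes T) = k"
    using bij_betw_same_card by fastforce
  have bij_\<sigma>: "bij_betw \<sigma> (set (leaves T)) {..<l}"
    unfolding bij_betw_def
  proof
    show "inj_on \<sigma> (set (leaves T))"
      using low_inj \<sigma> by (auto simp: inj_on_def edges_eq)
    have "\<exists>p\<in>set (leaves T). \<sigma> p = q" if "q < l" for q
    proof -
      have "Cod q \<in> givers" using that by (auto simp: givers_def)
      then obtain e where e: "e \<in> edges T" "low e = Cod q" using low_surj by blast
      then have "e \<in> set (leaves T)" using \<tau>[of e] by (auto simp: edges_eq var_out_def)
      then show ?thesis using \<sigma>[of e] e by auto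
    qed
    then show "\<sigma> ` set (leaves T) = {..<l}"
      using \<sigma> by (auto simp: image_iff)
  qed
  have len: "length (leaves T) = l"
    using bij_betw_same_card[OF bij_\<sigma>] distinct_card[OF distinct_leaves[of T]] by simp
  define \<rho> where "\<rho> q = (if q < l then \<sigma> (leaves T ! q) else q)" for q
  have \<rho>: "\<rho> permutes {..<l}"
  proof (rule bij_imp_permutes)
    have "bij_betw (\<lambda>q. leaves T ! q) {..<l} (set (leaves T))"
      using distinct_leaves[of T] len by (simp add: bij_betw_nth)
    from bij_betw_trans[OF this bij_\<sigma>] show "bij_betw \<rho> {..<l} {..<l}"
      by (rule bij_betw_cong[THEN iffD1, rotated]) (simp add: \<rho>_def)
  qed (simp add: \<rho>_def)
  have comb: "combed_tree T \<rho> \<tau>"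
    using bij_\<tau> \<rho> by (simp add: combed_tree_def card len)
  have node_arities: "node_arities T \<tau> = ms"
  proof (rule nth_equalityI)
    fix i assume "i < length (node_arities T \<tau>)"
    then have i: "i < k" by (simp add: node_arities_def card)
    then have "node_at T \<tau> i \<in> nodes T" "\<tau> (node_at T \<tau> i) = i"
      using bij_\<tau> by (auto simp: node_at_def bij_betw_def intro!: inv_into_into f_inv_into_f)
    then show "node_arities T \<tau> ! i = ms ! i"
      using \<tau> i by (simp add: node_arities_def card)
  qed (simp add: node_arities_def card)
  have "tree_graph T \<rho> \<tau> = (\<lambda>e. {low e, ?up e}) ` edges T"
    unfolding len[symmetric]
  proof (rule tree_graph_eq_edges[OF comb])
    fix q assume "q < length (leaves T)"
    then show "low (leaves T ! q) = Cod (\<rho> q)"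
      using \<sigma>[of "leaves T ! q"] by (simp add: \<rho>_def len)
  qed (simp_all add: \<tau> node_arities inp_def)
  also have "\<dots> = \<xi>"
  proof
    show "(\<lambda>e. {low e, ?up e}) ` edges T \<subseteq> \<xi>"
      using link by (auto simp: insert_commute)
    show "\<xi> \<subseteq> (\<lambda>e. {low e, ?up e}) ` edges T"
    proof
      fix d assume d: "d \<in> \<xi>"
      then have "card d = 2" using graph by (auto simp: is_graph_def)
      then obtain a b where "d = {a, b}" by (auto simp: card_2_iff)
      then obtain x y where xy: "d = {x, y}" "y \<in> givers"
        using d link_ends[of a b] by (metis UnE insert_commute)
      obtain e where e: "e \<in> edges T" "low e = y" using low_surj[OF xy(2)] by blast
      have "?up e = x"
        using link[OF e(1)] d xy(1) e(2) mate_unique[of y x "?up e"] by (simp add: insert_commute)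
      then show "d \<in> (\<lambda>e. {low e, ?up e}) ` edges T"
        using e xy(1) by (auto simp: insert_commute)
    qed
  qed
  finally show ?thesis using comb node_arities len by blast
qed

end

theorem corollary7p4:
  fixes ms :: "nat list" and l :: nat and \<xi> :: graph
  assumes "int l = int (sum_list ms) - int (length ms) + 1"
    and "is_graph (tensor_list (map X ms)) (X l) \<xi>"
  shows "(\<exists>T \<rho> \<tau>. combed_tree T \<rho> \<tau> \<and> node_arities T \<tau> = ms \<and> length (leaves T) = l \<and>
            \<xi> = tree_graph T \<rho> \<tau>)
         \<longleftrightarrow> allowable (tensor_list (map X ms)) (X l) \<xi>"
proof
  assume "\<exists>T \<rho> \<tau>. combed_tree T \<rho> \<tau> \<and> node_arities T \<tau> = ms \<and> length (leaves T) = l \<and>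
            \<xi> = tree_graph T \<rho> \<tau>"
  then show "allowable (tensor_list (map X ms)) (X l) \<xi>"
    using tree_allowable by blast
next
  assume "allowable (tensor_list (map X ms)) (X l) \<xi>"
  then have sound: "sound (tensor_list (map X ms)) (X l) \<xi>"
    by (rule allowable_sound)
  interpret X_graph ms l \<xi>
    using assms(2) by unfold_locales
  have wf: "wf child"
    using sound by (rule wf_child)
  obtain T low where "labels (Cod l) T low"
    using labels_exist[OF wf] .
  from labelled_tree[OF wf this]
  show "\<exists>T \<rho> \<tau>. combed_tree T \<rho> \<tau> \<and> node_arities T \<tau> = ms \<and> length (leaves T) = l \<and>
            \<xi> = tree_graph T \<rho> \<tau>"
    by blast
qed

end
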